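(* Let $\mathbb{X}=[X_1\rightrightarrows X_0]$ be a Lie groupoid with Lie algebroid $A=1^*\ker ds\to X_0$, let $(\omega,\sigma)$ be a connection pair on the principal $\mathbb{X}$-bundle $\pi\colon P\to M$, and let $\mathcal{H}=\ker\omega\subset TP$ be the subbundle associated to $\omega$. Let $\tilde\sigma$ be another Ehresmann connection on $\mathbb{X}$; write $\lambda,\tau$ (resp. $\tilde\lambda,\tilde\tau$) for the quasi actions on $A$ and $TP$ induced by $\sigma$ (resp. $\tilde\sigma$). If $\theta\colon TP\to P\times_{X_0}A$ is a smooth $A$-valued differential $1$-form satisfying $$\theta\circ d\delta=0,\qquad \theta_{pg}\bigl(\tilde\tau_g(u)\bigr)=\tilde\lambda_{g^{-1}}\theta_p(u)+(d\delta_{pg})^{-1}\bigl(\tilde\tau_g(u_1)-\tau_g(u_1)\bigr)\qquad(\ast)$$ for all $(p,g)$ with $a(p)=t(g)$ and all $u=u_1+u_2\in T_pP$ with $u_1\in\mathcal{H}_p$, $u_2\in(\ker d\pi)_p$, then $(\omega-\theta,\tilde\sigma)$ is a connection pair on $\pi\colon P\to M$. Conversely, if $(\omega,\sigma)$ and $(\tilde\omega,\tilde\sigma)$ are two connection pairs on $\pi\colon P\to M$, then $\theta=\omega-\tilde\omega$ satisfies $(\ast)$.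
   Context: Lie groupoid $\mathbb{X}=[X_1\rightrightarrows X_0]$: source $s$, target $t$ are submersions, $gh$ is defined when $s(g)=t(h)$, units $1_x$, inversion $i$. Right action on $P$ with anchor $a\colon P\to X_0$: $pg$ is defined when $a(p)=t(g)$, $a(pg)=s(g)$, $(pg)h=p(gh)$, $p1_{a(p)}=p$; for $(u,\beta)$ tangent to $P\times_{a,X_0,t}X_1$ at $(p,g)$, $u.\beta\in T_{pg}P$ is its image under the differential of the action. Principal $\mathbb{X}$-bundle: a surjective submersion $\pi\colon P\to M$ with a right action, $\pi(pg)=\pi(p)$, and $(p,g)\mapsto(p,pg)$ a diffeomorphism $P\times_{X_0}X_1\to P\times_MP$. $A_x=\ker(ds)_{1_x}$; $P\times_{X_0}A=a^*A$; an $A$-valued $1$-form on $P$ is a vector bundle map $TP\to P\times_{X_0}A$ over $P$. $r_g\colon A_{t(g)}\to T_gX_1$ is the differential at $1_{t(g)}$ of $h\mapsto hg$; $l_g\colon A_{s(g)}\to T_gX_1$ is the differential at $1_{s(g)}$ of $h\mapsto gh^{-1}$ on $s^{-1}(s(g))$. Ehresmann connection: a subbundle $\mathbb{H}\subset TX_1$ with $TX_1=\mathbb{H}\oplus\ker ds$ and $\mathbb{H}_{1_x}=(d1)_x(T_xX_0)$; equivalently $\sigma_g\colon T_{s(g)}X_0\to\mathbb{H}_g$, the inverse of $ds|_{\mathbb{H}_g}$. $\psi_g\colon T_gX_1\to A_{t(g)}$ satisfies $r_g\psi_g+\sigma_g(ds)_g=\mathrm{Id}$. Induced quasi actions: $\lambda_g=-\psi_gl_g\colon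 A_{s(g)}\to A_{t(g)}$ and, for $a(p)=t(g)$, $\tau_g\colon T_pP\to T_{pg}P$, $\tau_g(u)=u.(di)_{g^{-1}}\sigma_{g^{-1}}(da)_p(u)$. $d\delta_p\colon A_{a(p)}\to T_pP$ is the differential at $1_{a(p)}$ of $s^{-1}(a(p))\to\pi^{-1}(\pi(p))$, $h\mapsto ph^{-1}$; it is an isomorphism onto $\ker(d\pi)_p$, and $\tilde\tau_g(u_1)-\tau_g(u_1)$ lies in $\ker(d\pi)_{pg}$. A connection pair $(\omega,\sigma)$ consists of an Ehresmann connection $\sigma$ on $\mathbb{X}$ and a smooth $A$-valued $1$-form $\omega$ on $P$ with $\omega_{pg}(\tau_g(u))=\lambda_{g^{-1}}(\omega_p(u))$ for all $u\in T_pP$, $a(p)=t(g)$, and $\omega_p(d\delta_p(\alpha))=\alpha$ for $\alpha\in A_{a(p)}$; then $TP=\ker\omega\oplus\ker d\pi$. *)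

theory Defs
  imports "HOL-Analysis.Analysis"
begin

text \<open>
  Manifolds are modelled on finite-dimensional real inner product spaces. The class below is
  \<^class>\<open>euclidean_space\<close> without the requirement that a basis be nonempty. Dimension zero has to
  be allowed, since otherwise a Lie group, i.e. a Lie groupoid over a point, would be excluded.
\<close>

class model_space = real_inner +
  assumes ex_orthonormal_basis:
    "\<exists>B. finite B \<and> (\<forall>u\<in>B. \<forall>v\<in>B. inner u v = (if u = v then 1 else 0)) \<and>
         (\<forall>x. (\<forall>u\<in>B. inner x u = 0) \<longleftrightarrow> x = 0)"

instance euclidean_space \<subseteq> model_space
proof
  show "\<exists>B::'a set. finite B \<and> (\<forall>u\<in>B. \<forall>v\<in>B. inner u v = (if u = v then 1 else 0)) \<and>
         (\<forall>x. (\<forall>u\<in>B. inner x u = 0) \<longleftrightarrow> x = 0)"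
    by (rule exI[of _ Basis]) (simp add: inner_Basis euclidean_all_zero_iff)
qed

instance prod :: (model_space, model_space) model_space
proof
  obtain B :: "'a set" where B: "finite B" "\<And>u v. u \<in> B \<Longrightarrow> v \<in> B \<Longrightarrow> inner u v = (if u = v then 1 else 0)"
    "\<And>x. (\<forall>u\<in>B. inner x u = 0) \<longleftrightarrow> x = 0"
    using ex_orthonormal_basis[where 'a = 'a] by metis
  obtain C :: "'b set" where C: "finite C" "\<And>u v. u \<in> C \<Longrightarrow> v \<in> C \<Longrightarrow> inner u v = (if u = v then 1 else 0)"
    "\<And>x. (\<forall>u\<in>C. inner x u = 0) \<longleftrightarrow> x = 0"
    using ex_orthonormal_basis[where 'a = 'b] by metis
  let ?D = "(\<lambda>u. (u, 0)) ` B \<union> (\<lambda>v. (0, v)) ` C"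
  have "finite ?D" using B(1) C(1) by simp
  moreover have "\<forall>u\<in>?D. \<forall>v\<in>?D. inner u v = (if u = v then 1 else 0)"
    using B(2) C(2) B(2)[of 0 0] C(2)[of 0 0]
    by (auto simp: inner_prod_def split: if_split_asm)
  moreover have "\<forall>x. (\<forall>u\<in>?D. inner x u = 0) \<longleftrightarrow> x = 0"
    unfolding ball_Un ball_simps by (simp add: inner_prod_def prod_eq_iff B(3) C(3))
  ultimately show "\<exists>D::('a \<times> 'b) set. finite D \<and> (\<forall>u\<in>D. \<forall>v\<in>D. inner u v = (if u = v then 1 else 0)) \<and>
         (\<forall>x. (\<forall>u\<in>D. inner x u = 0) \<longleftrightarrow> x = 0)"
    by (intro exI[of _ ?D] conjI)
qed

text \<open>The point \<open>\<real>\<^sup>0\<close>, as a witness for dimension zero.\<close>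

instantiation unit :: model_space
begin

definition zero_unit :: unit where "zero_unit = ()"
definition plus_unit :: "unit \<Rightarrow> unit \<Rightarrow> unit" where "plus_unit x y = ()"
definition minus_unit :: "unit \<Rightarrow> unit \<Rightarrow> unit" where "minus_unit x y = ()"
definition uminus_unit :: "unit \<Rightarrow> unit" where "uminus_unit x = ()"
definition scaleR_unit :: "real \<Rightarrow> unit \<Rightarrow> unit" where "scaleR_unit r x = ()"
definition inner_unit :: "unit \<Rightarrow> unit \<Rightarrow> real" where "inner_unit x y = 0"
definition norm_unit :: "unit \<Rightarrow> real" where "norm_unit x = 0"
definition dist_unit :: "unit \<Rightarrow> unit \<Rightarrow> real" where "dist_unit x y = 0"
definition sgn_unit :: "unit \<Rightarrow> unit" where "sgn_unit x = ()"
definition uniformity_unit :: "(unit \<times> unit) filter"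
  where "uniformity_unit = (INF e\<in>{0<..}. principal {(x, y). dist x y < e})"
definition open_unit :: "unit set \<Rightarrow> bool"
  where "open_unit U \<longleftrightarrow> (\<forall>x\<in>U. \<forall>\<^sub>F (x', y) in uniformity. x' = x \<longrightarrow> y \<in> U)"

instance
  by standard
    (simp_all add: inner_unit_def norm_unit_def dist_unit_def uniformity_unit_def open_unit_def exI[of _ "{}"])

end

text \<open>\<open>Ck_on k f S\<close> is only used for open \<open>S\<close>. By finite dimension of the domain, continuity of all
  iterated directional derivatives is continuity of the iterated derivatives.\<close>

primrec Ck_on :: "nat \<Rightarrow> ('a::real_normed_vector \<Rightarrow> 'b::real_normed_vector) \<Rightarrow> 'a set \<Rightarrow> bool" where
  "Ck_on 0 f S \<longleftrightarrow> continuous_on S f"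
| "Ck_on (Suc k) f S \<longleftrightarrow> (\<forall>x\<in>S. f differentiable (at x)) \<and>
     (\<forall>v. Ck_on k (\<lambda>x. frechet_derivative f (at x) v) S)"

definition smooth_on :: "'a::real_normed_vector set \<Rightarrow> ('a \<Rightarrow> 'b::real_normed_vector) \<Rightarrow> bool" where
  "smooth_on S f \<longleftrightarrow> (\<forall>k. Ck_on k f S)"

type_synonym ('a, 'e) chart = "'a set \<times> ('a \<Rightarrow> 'e)"

definition chart_inv :: "('a, 'e) chart \<Rightarrow> 'e \<Rightarrow> 'a" where
  "chart_inv c = inv_into (fst c) (snd c)"

text \<open>
  The underlying space of a manifold is a whole type, whose topology is the manifold topology.
  A manifold carries an atlas and, for every point \<open>p\<close>, a preferred chart of the atlas around
  \<open>p\<close>. The tangent space at \<open>p\<close> is the model space \<open>'e\<close>: a tangent vector is represented by its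
  coordinates in the preferred chart at \<open>p\<close>. The choice is immaterial: coordinates in any other
  chart are obtained with \<open>coord_change\<close>.
\<close>

record ('a, 'e) manifold =
  charts :: "('a, 'e) chart set"
  chart_at :: "'a \<Rightarrow> ('a, 'e) chart"

definition smooth_manifold ::
  "('a::{t2_space, second_countable_topology}, 'e::model_space) manifold \<Rightarrow> bool" where
  "smooth_manifold N \<longleftrightarrow>
    (\<forall>p. chart_at N p \<in> charts N \<and> p \<in> fst (chart_at N p)) \<and>
    (\<forall>c\<in>charts N. open (fst c) \<and> open (snd c ` fst c) \<and>
       homeomorphism (fst c) (snd c ` fst c) (snd c) (chart_inv c)) \<and>
    (\<forall>c\<in>charts N. \<forall>d\<in>charts N. smooth_on (snd c ` (fst c \<inter> fst d)) (snd d \<circ> chart_inv c))"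

definition prod_chart :: "('a, 'e) chart \<Rightarrow> ('b, 'f) chart \<Rightarrow> ('a \<times> 'b, 'e \<times> 'f) chart" where
  "prod_chart c d = (fst c \<times> fst d, map_prod (snd c) (snd d))"

text \<open>With this choice of preferred charts, \<open>T\<^bsub>(p,q)\<^esub>(N \<times> Q)\<close> is literally
  \<open>T\<^sub>p N \<times> T\<^sub>q Q\<close>.\<close>

definition prod_manifold ::
  "('a, 'e) manifold \<Rightarrow> ('b, 'f) manifold \<Rightarrow> ('a \<times> 'b, 'e \<times> 'f) manifold" where
  "prod_manifold N Q = \<lparr>charts = {prod_chart c d |c d. c \<in> charts N \<and> d \<in> charts Q},
     chart_at = (\<lambda>(p, q). prod_chart (chart_at N p) (chart_at Q q))\<rparr>"

definition smooth_map_on ::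
  "('a::topological_space, 'e::model_space) manifold \<Rightarrow> ('b::topological_space, 'f::model_space) manifold \<Rightarrow>
   'a set \<Rightarrow> ('a \<Rightarrow> 'b) \<Rightarrow> bool" where
  "smooth_map_on N Q W f \<longleftrightarrow> continuous_on W f \<and>
    (\<forall>c\<in>charts N. \<forall>d\<in>charts Q.
       smooth_on (snd c ` (W \<inter> fst c \<inter> f -` fst d)) (snd d \<circ> f \<circ> chart_inv c))"

abbreviation smooth_map ::
  "('a::topological_space, 'e::model_space) manifold \<Rightarrow> ('b::topological_space, 'f::model_space) manifold \<Rightarrow>
   ('a \<Rightarrow> 'b) \<Rightarrow> bool" where
  "smooth_map N Q f \<equiv> smooth_map_on N Q UNIV f"

definition tangent_map ::
  "('a, 'e::model_space) manifold \<Rightarrow> ('b, 'f::model_space) manifold \<Rightarrow> ('a \<Rightarrow> 'b) \<Rightarrow> 'a \<Rightarrow> 'e \<Rightarrow> 'f" where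
  "tangent_map N Q f p =
     frechet_derivative (snd (chart_at Q (f p)) \<circ> f \<circ> chart_inv (chart_at N p))
       (at (snd (chart_at N p) p))"

definition submersion ::
  "('a::topological_space, 'e::model_space) manifold \<Rightarrow> ('b::topological_space, 'f::model_space) manifold \<Rightarrow>
   ('a \<Rightarrow> 'b) \<Rightarrow> bool" where
  "submersion N Q f \<longleftrightarrow> smooth_map N Q f \<and> (\<forall>p. surj (tangent_map N Q f p))"

text \<open>
  Fibre products and fibres of submersions are embedded submanifolds \<open>S\<close> of an ambient manifold
  \<open>N\<close>. A map on \<open>S\<close> is smooth for the submanifold structure iff it locally extends to a smooth map
  on an open subset of \<open>N\<close>, and its differential is the restriction to \<open>TS \<subseteq> TN|\<^sub>S\<close> of the
  differential of any such extension. The value of \<open>tangent_map_within\<close> is meaningful only at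
  vectors \<open>v\<close> tangent to \<open>S\<close>, where it does not depend on the extension.
\<close>

definition local_extension ::
  "('a::topological_space, 'e::model_space) manifold \<Rightarrow> ('b::topological_space, 'f::model_space) manifold \<Rightarrow>
   'a set \<Rightarrow> ('a \<Rightarrow> 'b) \<Rightarrow> 'a \<Rightarrow> ('a \<Rightarrow> 'b) \<Rightarrow> bool" where
  "local_extension N Q S f p F \<longleftrightarrow>
     (\<exists>W. open W \<and> p \<in> W \<and> smooth_map_on N Q W F \<and> (\<forall>x\<in>W \<inter> S. F x = f x))"

definition smooth_map_within ::
  "('a::topological_space, 'e::model_space) manifold \<Rightarrow> ('b::topological_space, 'f::model_space) manifold \<Rightarrow>
   'a set \<Rightarrow> ('a \<Rightarrow> 'b) \<Rightarrow> bool" where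
  "smooth_map_within N Q S f \<longleftrightarrow> (\<forall>p\<in>S. \<exists>F. local_extension N Q S f p F)"

definition tangent_map_within ::
  "('a::topological_space, 'e::model_space) manifold \<Rightarrow> ('b::topological_space, 'f::model_space) manifold \<Rightarrow>
   'a set \<Rightarrow> ('a \<Rightarrow> 'b) \<Rightarrow> 'a \<Rightarrow> 'e \<Rightarrow> 'f" where
  "tangent_map_within N Q S f p v =
     (THE w. \<exists>F. local_extension N Q S f p F \<and> w = tangent_map N Q F p v)"

definition diffeomorphism_within ::
  "('a::topological_space, 'e::model_space) manifold \<Rightarrow> ('b::topological_space, 'f::model_space) manifold \<Rightarrow>
   'a set \<Rightarrow> 'b set \<Rightarrow> ('a \<Rightarrow> 'b) \<Rightarrow> bool" where
  "diffeomorphism_within N Q S T f \<longleftrightarrow> bij_betw f S T \<and>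
     smooth_map_within N Q S f \<and> smooth_map_within Q N T (inv_into S f)"

text \<open>\<open>coord_change c d p\<close> maps the coordinates of a tangent vector at \<open>p\<close> in the chart \<open>c\<close> to its
  coordinates in the chart \<open>d\<close>.\<close>

definition coord_change ::
  "('a, 'e::model_space) chart \<Rightarrow> ('a, 'e) chart \<Rightarrow> 'a \<Rightarrow> 'e \<Rightarrow> 'e" where
  "coord_change c d p = frechet_derivative (snd d \<circ> chart_inv c) (at (snd c p))"

definition smooth_vector_field_on ::
  "('a::topological_space, 'e::model_space) manifold \<Rightarrow> 'a set \<Rightarrow> ('a \<Rightarrow> 'e) \<Rightarrow> bool" where
  "smooth_vector_field_on N W Y \<longleftrightarrow>
     (\<forall>c\<in>charts N. smooth_on (snd c ` (W \<inter> fst c))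
        (\<lambda>x. let p = chart_inv c x in coord_change (chart_at N p) c p (Y p)))"

definition smooth_subbundle ::
  "('a::topological_space, 'e::model_space) manifold \<Rightarrow> ('a \<Rightarrow> 'e set) \<Rightarrow> bool" where
  "smooth_subbundle N H \<longleftrightarrow> (\<exists>k::nat. \<forall>q. \<exists>W Y. open W \<and> q \<in> W \<and>
     (\<forall>i<k. smooth_vector_field_on N W (Y i)) \<and>
     (\<forall>p\<in>W. inj_on (\<lambda>i. Y i p) {..<k} \<and> independent ((\<lambda>i. Y i p) ` {..<k}) \<and>
        H p = span ((\<lambda>i. Y i p) ` {..<k})))"

text \<open>A smooth bundle map \<open>TN \<rightarrow> TQ\<close> over a smooth map \<open>f\<close>: fibrewise linear maps
  \<open>F\<^sub>p: T\<^sub>p N \<rightarrow> T\<^bsub>f p\<^esub> Q\<close> such that \<open>(p, v) \<mapsto> F\<^sub>p v\<close> is smooth in the charts of the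
  tangent bundles induced by charts of \<open>N\<close> and \<open>Q\<close>.\<close>

definition smooth_bundle_map ::
  "('a::topological_space, 'e::model_space) manifold \<Rightarrow> ('b::topological_space, 'f::model_space) manifold \<Rightarrow>
   ('a \<Rightarrow> 'b) \<Rightarrow> ('a \<Rightarrow> 'e \<Rightarrow> 'f) \<Rightarrow> bool" where
  "smooth_bundle_map N Q f F \<longleftrightarrow> smooth_map N Q f \<and> (\<forall>p. linear (F p)) \<and>
     (\<forall>c\<in>charts N. \<forall>d\<in>charts Q. smooth_on ((snd c ` (fst c \<inter> f -` fst d)) \<times> UNIV)
        (\<lambda>(x, v). let p = chart_inv c x in
           coord_change (chart_at Q (f p)) d (f p) (F p (coord_change c (chart_at N p) p v))))"

text \<open>\<open>mult X g h\<close> is meaningful only if \<open>src X g = tgt X h\<close>.\<close>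

record ('o, 'eo, 'g, 'eg) groupoid =
  objs :: "('o, 'eo) manifold"
  arrs :: "('g, 'eg) manifold"
  src :: "'g \<Rightarrow> 'o"
  tgt :: "'g \<Rightarrow> 'o"
  mult :: "'g \<Rightarrow> 'g \<Rightarrow> 'g"
  ident :: "'o \<Rightarrow> 'g"
  invs :: "'g \<Rightarrow> 'g"

definition lie_groupoid ::
  "('o::{t2_space, second_countable_topology}, 'eo::model_space,
    'g::{t2_space, second_countable_topology}, 'eg::model_space) groupoid \<Rightarrow> bool" where
  "lie_groupoid X \<longleftrightarrow>
     smooth_manifold (objs X) \<and> smooth_manifold (arrs X) \<and>
     submersion (arrs X) (objs X) (src X) \<and> submersion (arrs X) (objs X) (tgt X) \<and>
     smooth_map (objs X) (arrs X) (ident X) \<and> smooth_map (arrs X) (arrs X) (invs X) \<and>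
     smooth_map_within (prod_manifold (arrs X) (arrs X)) (arrs X)
       {(g, h). src X g = tgt X h} (\<lambda>(g, h). mult X g h) \<and>
     (\<forall>x. src X (ident X x) = x \<and> tgt X (ident X x) = x) \<and>
     (\<forall>g h. src X g = tgt X h \<longrightarrow>
        src X (mult X g h) = src X h \<and> tgt X (mult X g h) = tgt X g) \<and>
     (\<forall>g h k. src X g = tgt X h \<and> src X h = tgt X k \<longrightarrow>
        mult X (mult X g h) k = mult X g (mult X h k)) \<and>
     (\<forall>g. mult X (ident X (tgt X g)) g = g \<and> mult X g (ident X (src X g)) = g) \<and>
     (\<forall>g. src X (invs X g) = tgt X g \<and> tgt X (invs X g) = src X g \<and>
        mult X g (invs X g) = ident X (tgt X g) \<and> mult X (invs X g) g = ident X (src X g))"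

definition ker_ds ::
  "('o, 'eo::model_space, 'g, 'eg::model_space) groupoid \<Rightarrow> 'g \<Rightarrow> 'eg set" where
  "ker_ds X g = {v. tangent_map (arrs X) (objs X) (src X) g v = 0}"

definition algebroid_fibre ::
  "('o, 'eo::model_space, 'g, 'eg::model_space) groupoid \<Rightarrow> 'o \<Rightarrow> 'eg set" where
  "algebroid_fibre X x = ker_ds X (ident X x)"

text \<open>\<open>r\<^sub>g\<close> and \<open>l\<^sub>g\<close>; as \<open>T(s\<inverse>(x)) = ker ds\<close>, both are meaningful only on
  \<open>A\<^bsub>t(g)\<^esub>\<close> and \<open>A\<^bsub>s(g)\<^esub>\<close>, respectively.\<close>

definition right_diff ::
  "('o, 'eo::model_space, 'g::topological_space, 'eg::model_space) groupoid \<Rightarrow> 'g \<Rightarrow> 'eg \<Rightarrow> 'eg" where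
  "right_diff X g =
     tangent_map_within (arrs X) (arrs X) {h. src X h = tgt X g} (\<lambda>h. mult X h g) (ident X (tgt X g))"

definition left_diff ::
  "('o, 'eo::model_space, 'g::topological_space, 'eg::model_space) groupoid \<Rightarrow> 'g \<Rightarrow> 'eg \<Rightarrow> 'eg" where
  "left_diff X g =
     tangent_map_within (arrs X) (arrs X) {h. src X h = src X g} (\<lambda>h. mult X g (invs X h))
       (ident X (src X g))"

definition ehresmann_connection ::
  "('o, 'eo::model_space, 'g::topological_space, 'eg::model_space) groupoid \<Rightarrow> ('g \<Rightarrow> 'eg set) \<Rightarrow> bool" where
  "ehresmann_connection X H \<longleftrightarrow> smooth_subbundle (arrs X) H \<and>
     (\<forall>g. H g \<inter> ker_ds X g = {0} \<and> (\<forall>v. \<exists>h\<in>H g. \<exists>k\<in>ker_ds X g. v = h + k)) \<and>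
     (\<forall>x. H (ident X x) = range (tangent_map (objs X) (arrs X) (ident X) x))"

text \<open>\<open>\<sigma>\<^sub>g\<close>, \<open>\<psi>\<^sub>g\<close> and \<open>\<lambda>\<^sub>g\<close> of the connection given by \<open>H\<close>.\<close>

definition hor_lift ::
  "('o, 'eo::model_space, 'g, 'eg::model_space) groupoid \<Rightarrow> ('g \<Rightarrow> 'eg set) \<Rightarrow> 'g \<Rightarrow> 'eo \<Rightarrow> 'eg" where
  "hor_lift X H g = the_inv_into (H g) (tangent_map (arrs X) (objs X) (src X) g)"

definition vert_part ::
  "('o, 'eo::model_space, 'g::topological_space, 'eg::model_space) groupoid \<Rightarrow> ('g \<Rightarrow> 'eg set) \<Rightarrow>
   'g \<Rightarrow> 'eg \<Rightarrow> 'eg" where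
  "vert_part X H g v = (THE \<alpha>. \<alpha> \<in> algebroid_fibre X (tgt X g) \<and>
     right_diff X g \<alpha> + hor_lift X H g (tangent_map (arrs X) (objs X) (src X) g v) = v)"

definition quasi_action_alg ::
  "('o, 'eo::model_space, 'g::topological_space, 'eg::model_space) groupoid \<Rightarrow> ('g \<Rightarrow> 'eg set) \<Rightarrow>
   'g \<Rightarrow> 'eg \<Rightarrow> 'eg" where
  "quasi_action_alg X H g \<alpha> = - vert_part X H g (left_diff X g \<alpha>)"

text \<open>\<open>act B p g\<close> is meaningful only if \<open>anchor B p = tgt X g\<close>.\<close>

record ('p, 'ep, 'm, 'em, 'o, 'g) gpd_bundle =
  total :: "('p, 'ep) manifold"
  base :: "('m, 'em) manifold"
  proj :: "'p \<Rightarrow> 'm"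
  anchor :: "'p \<Rightarrow> 'o"
  act :: "'p \<Rightarrow> 'g \<Rightarrow> 'p"

definition action_domain ::
  "('o, 'eo, 'g, 'eg) groupoid \<Rightarrow> ('p, 'ep, 'm, 'em, 'o, 'g) gpd_bundle \<Rightarrow> ('p \<times> 'g) set" where
  "action_domain X B = {(p, g). anchor B p = tgt X g}"

definition right_action ::
  "('o::topological_space, 'eo::model_space, 'g::topological_space, 'eg::model_space) groupoid \<Rightarrow>
   ('p::topological_space, 'ep::model_space, 'm, 'em, 'o, 'g) gpd_bundle \<Rightarrow> bool" where
  "right_action X B \<longleftrightarrow>
     smooth_map (total B) (objs X) (anchor B) \<and>
     smooth_map_within (prod_manifold (total B) (arrs X)) (total B)
       (action_domain X B) (\<lambda>(p, g). act B p g) \<and>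
     (\<forall>p g. anchor B p = tgt X g \<longrightarrow> anchor B (act B p g) = src X g) \<and>
     (\<forall>p g h. anchor B p = tgt X g \<and> src X g = tgt X h \<longrightarrow>
        act B (act B p g) h = act B p (mult X g h)) \<and>
     (\<forall>p. act B p (ident X (anchor B p)) = p)"

definition principal_bundle ::
  "('o::topological_space, 'eo::model_space, 'g::topological_space, 'eg::model_space) groupoid \<Rightarrow>
   ('p::{t2_space, second_countable_topology}, 'ep::model_space,
    'm::{t2_space, second_countable_topology}, 'em::model_space, 'o, 'g) gpd_bundle \<Rightarrow> bool" where
  "principal_bundle X B \<longleftrightarrow>
     smooth_manifold (total B) \<and> smooth_manifold (base B) \<and>
     submersion (total B) (base B) (proj B) \<and> surj (proj B) \<and>
     right_action X B \<and>
     (\<forall>p g. anchor B p = tgt X g \<longrightarrow> proj B (act B p g) = proj B p) \<and>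
     diffeomorphism_within
       (prod_manifold (total B) (arrs X)) (prod_manifold (total B) (total B))
       (action_domain X B) {(p, q). proj B p = proj B q} (\<lambda>(p, g). (p, act B p g))"

definition ker_dpi ::
  "('p, 'ep::model_space, 'm, 'em::model_space, 'o, 'g) gpd_bundle \<Rightarrow> 'p \<Rightarrow> 'ep set" where
  "ker_dpi B p = {u. tangent_map (total B) (base B) (proj B) p u = 0}"

text \<open>\<open>u.\<beta>\<close>, for \<open>(u, \<beta>)\<close> tangent to \<open>P \<times>\<^bsub>a, X\<^sub>0, t\<^esub> X\<^sub>1\<close> at \<open>(p, g)\<close>.\<close>

definition act_diff ::
  "('o, 'eo, 'g::topological_space, 'eg::model_space) groupoid \<Rightarrow>
   ('p::topological_space, 'ep::model_space, 'm, 'em, 'o, 'g) gpd_bundle \<Rightarrow>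
   'p \<Rightarrow> 'g \<Rightarrow> 'ep \<Rightarrow> 'eg \<Rightarrow> 'ep" where
  "act_diff X B p g u \<beta> =
     tangent_map_within (prod_manifold (total B) (arrs X)) (total B)
       (action_domain X B) (\<lambda>(p, g). act B p g) (p, g) (u, \<beta>)"

text \<open>\<open>\<tau>\<^sub>g(u)\<close> for \<open>u \<in> T\<^sub>p P\<close>.\<close>

definition quasi_action_tangent ::
  "('o, 'eo::model_space, 'g::topological_space, 'eg::model_space) groupoid \<Rightarrow>
   ('p::topological_space, 'ep::model_space, 'm, 'em, 'o, 'g) gpd_bundle \<Rightarrow> ('g \<Rightarrow> 'eg set) \<Rightarrow>
   'p \<Rightarrow> 'g \<Rightarrow> 'ep \<Rightarrow> 'ep" where
  "quasi_action_tangent X B H p g u =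
     act_diff X B p g u
       (tangent_map (arrs X) (arrs X) (invs X) (invs X g)
          (hor_lift X H (invs X g) (tangent_map (total B) (objs X) (anchor B) p u)))"

text \<open>\<open>d\<delta>\<^sub>p\<close>, meaningful on \<open>A\<^bsub>a(p)\<^esub>\<close>. Its values are in \<open>T\<^sub>p P\<close> because
  \<open>p1\<inverse> = p\<close>.\<close>

definition delta_diff ::
  "('o, 'eo, 'g::topological_space, 'eg::model_space) groupoid \<Rightarrow>
   ('p::topological_space, 'ep::model_space, 'm, 'em, 'o, 'g) gpd_bundle \<Rightarrow> 'p \<Rightarrow> 'eg \<Rightarrow> 'ep" where
  "delta_diff X B p =
     tangent_map_within (arrs X) (total B) {h. src X h = anchor B p} (\<lambda>h. act B p (invs X h))
       (ident X (anchor B p))"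

text \<open>Smooth \<open>A\<close>-valued 1-forms on \<open>P\<close>. As \<open>P \<times>\<^bsub>X\<^sub>0\<^esub> A = a\<^sup>*A\<close> is the pullback along \<open>1 \<circ> a\<close> of a
  subbundle of \<open>TX\<^sub>1\<close>, they are smooth bundle maps \<open>TP \<rightarrow> TX\<^sub>1\<close> over \<open>1 \<circ> a\<close> with values in \<open>A\<close>.\<close>

definition algebroid_form ::
  "('o, 'eo::model_space, 'g::topological_space, 'eg::model_space) groupoid \<Rightarrow>
   ('p::topological_space, 'ep::model_space, 'm, 'em, 'o, 'g) gpd_bundle \<Rightarrow> ('p \<Rightarrow> 'ep \<Rightarrow> 'eg) \<Rightarrow> bool" where
  "algebroid_form X B \<omega> \<longleftrightarrow>
     smooth_bundle_map (total B) (arrs X) (ident X \<circ> anchor B) \<omega> \<and>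
     (\<forall>p u. \<omega> p u \<in> algebroid_fibre X (anchor B p))"

definition connection_pair ::
  "('o, 'eo::model_space, 'g::topological_space, 'eg::model_space) groupoid \<Rightarrow>
   ('p::topological_space, 'ep::model_space, 'm, 'em, 'o, 'g) gpd_bundle \<Rightarrow>
   ('p \<Rightarrow> 'ep \<Rightarrow> 'eg) \<Rightarrow> ('g \<Rightarrow> 'eg set) \<Rightarrow> bool" where
  "connection_pair X B \<omega> H \<longleftrightarrow>
     ehresmann_connection X H \<and> algebroid_form X B \<omega> \<and>
     (\<forall>p g u. anchor B p = tgt X g \<longrightarrow>
        \<omega> (act B p g) (quasi_action_tangent X B H p g u) = quasi_action_alg X H (invs X g) (\<omega> p u)) \<and>
     (\<forall>p. \<forall>\<alpha>\<in>algebroid_fibre X (anchor B p). \<omega> p (delta_diff X B p \<alpha>) = \<alpha>)"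

text \<open>The two conditions \<open>(\<ast>)\<close> on \<open>\<theta>\<close>, with \<open>H\<close> and \<open>H'\<close> the connections \<open>\<sigma>\<close> and
  \<open>\<sigma>\<tilde>\<close>, and \<open>ker \<omega>\<close> the horizontal subbundle of \<open>TP\<close>.\<close>

definition change_condition ::
  "('o, 'eo::model_space, 'g::topological_space, 'eg::model_space) groupoid \<Rightarrow>
   ('p::topological_space, 'ep::model_space, 'm, 'em::model_space, 'o, 'g) gpd_bundle \<Rightarrow>
   ('p \<Rightarrow> 'ep \<Rightarrow> 'eg) \<Rightarrow> ('g \<Rightarrow> 'eg set) \<Rightarrow> ('g \<Rightarrow> 'eg set) \<Rightarrow> ('p \<Rightarrow> 'ep \<Rightarrow> 'eg) \<Rightarrow> bool" where
  "change_condition X B \<omega> H H' \<theta> \<longleftrightarrow>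
     (\<forall>p. \<forall>\<alpha>\<in>algebroid_fibre X (anchor B p). \<theta> p (delta_diff X B p \<alpha>) = 0) \<and>
     (\<forall>p g u u\<^sub>1 u\<^sub>2. anchor B p = tgt X g \<and> \<omega> p u\<^sub>1 = 0 \<and> u\<^sub>2 \<in> ker_dpi B p \<and> u = u\<^sub>1 + u\<^sub>2 \<longrightarrow>
        \<theta> (act B p g) (quasi_action_tangent X B H' p g u) =
          quasi_action_alg X H' (invs X g) (\<theta> p u) +
          the_inv_into (algebroid_fibre X (anchor B (act B p g))) (delta_diff X B (act B p g))
            (quasi_action_tangent X B H' p g u\<^sub>1 - quasi_action_tangent X B H p g u\<^sub>1))"

end

theory Submission
  imports Defs
begin

text \<open>
  Every differential on a fibre or fibre product is computed on velocities of curves: by the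
  implicit function theorem each tangent vector of such a subset is the velocity of a curve in it,
  which makes \<^const>\<open>tangent_map_within\<close> well defined and linear.

  For any Ehresmann connection, differentiating \<open>(p \<eta>\<inverse>) (j \<eta>\<inverse>)\<inverse> = (p g) (j g)\<inverse>\<close> gives
  \<open>\<tau>\<^sub>g \<circ> d\<delta>\<^sub>p = d\<delta>\<^bsub>pg\<^esub> \<circ> \<lambda>\<^bsub>g\<inverse>\<^esub>\<close>. If \<open>\<omega> \<circ> d\<delta> = id\<close>, then \<open>\<omega>\<close> inverts \<open>d\<delta>\<close> on
  \<open>ker d\<pi>\<close>. Hence for a connection pair \<open>(\<omega>, \<sigma>)\<close> and a vector
  \<open>u = u\<^sub>1 + u\<^sub>2\<close> with \<open>\<omega> u\<^sub>1 = 0\<close> and \<open>u\<^sub>2 \<in> ker d\<pi>\<close>, the value of \<open>\<omega>\<close> at \<open>\<tau>' u\<close> is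
  \<open>\<omega> (\<tau>' u\<^sub>1 - \<tau> u\<^sub>1) + \<lambda>' (\<omega> u\<^sub>2) = d\<delta>\<inverse> (\<tau>' u\<^sub>1 - \<tau> u\<^sub>1) + \<lambda>' (\<omega> u)\<close>,
  and both directions follow by subtraction.
\<close>

section \<open>Calculus on model spaces\<close>

text \<open>No manifold structure is built on fibres and fibre products: such a set enters only
  through the curves it contains. This makes the partially defined operations tractable.
  Multiplication and action are smooth only along composable pairs, and their laws hold only there,
  so an identity between differentials is proved by exhibiting one curve, checking a groupoid
  identity at every time, and using uniqueness of velocities. Splitting a differential in two
  arguments is legitimate only if each summand is tangent by itself; the curves in source fibres are
  chosen for that reason.

  The map \<psi> is a definite description, and \<lambda> inherits this. A value of \<lambda> is
  therefore produced as the velocity of an explicit curve and then recognized, and the linearity of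
  \<lambda> is read off from \<open>\<tau> d\<delta> = d\<delta> \<lambda>\<close> by applying
  \<omega>. That argument rests on the normalization \<open>\<omega> d\<delta> = id\<close> alone,
  so it also serves the second connection, under which \<omega> is in general not
  equivariant.\<close>

lemma model_space_basis:
  obtains B :: "'a::model_space set" where "finite B" "\<And>x. x = (\<Sum>b\<in>B. inner x b *\<^sub>R b)"
proof -
  obtain B :: "'a set" where B: "finite B"
    "\<And>u v. u \<in> B \<Longrightarrow> v \<in> B \<Longrightarrow> inner u v = (if u = v then 1 else 0)"
    "\<And>x. (\<forall>u\<in>B. inner x u = 0) \<longleftrightarrow> x = 0"
    using ex_orthonormal_basis[where 'a = 'a] by metis
  have "x - (\<Sum>b\<in>B. inner x b *\<^sub>R b) = 0" for x
  proof -
    \<comment> \<open>Orthogonality to every basis vector forces a vector to be 0, by the last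
      clause of the class axiom.\<close>
    have "inner (x - (\<Sum>b\<in>B. inner x b *\<^sub>R b)) u = 0" if "u \<in> B" for u
    proof -
      have "inner (\<Sum>b\<in>B. inner x b *\<^sub>R b) u = (\<Sum>b\<in>B. inner x b * (if b = u then 1 else 0))"
        using that by (simp add: inner_sum_left B(2) cong: sum.cong)
      also have "\<dots> = inner x u"
        using that B(1) by (simp add: if_distrib[of "\<lambda>c. inner x _ * c"] cong: if_cong)
      finally show ?thesis by (simp add: inner_diff_left)
    qed
    then show ?thesis using B(3) by blast
  qed
  then show thesis using that[OF B(1)] by (metis eq_iff_diff_eq_0)
qed

lemma linear_basis_expansion:
  fixes f :: "'a::model_space \<Rightarrow> 'b::real_vector"
  assumes "linear f" "\<And>x. x = (\<Sum>b\<in>B. inner x b *\<^sub>R b)"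
  shows "f x = (\<Sum>b\<in>B. inner x b *\<^sub>R f b)"
proof -
  have "f x = f (\<Sum>b\<in>B. inner x b *\<^sub>R b)"
    using assms(2) by simp
  then show ?thesis
    by (simp add: linear_sum[OF assms(1)] linear_scale[OF assms(1)])
qed

text \<open>Finite dimension in the form of automatic continuity. It provides the bound on the right
  inverse in \<open>implicit_curve\<close>, which is only known to be linear.\<close>

lemma linear_bounded_linear:
  fixes f :: "'a::model_space \<Rightarrow> 'b::real_normed_vector"
  assumes "linear f"
  shows "bounded_linear f"
proof -
  obtain B :: "'a set" where "finite B" and B: "\<And>x. x = (\<Sum>b\<in>B. inner x b *\<^sub>R b)"
    using model_space_basis by blast
  have "f = (\<lambda>x. \<Sum>b\<in>B. inner x b *\<^sub>R f b)"
    using linear_basis_expansion[OF assms B] by blast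
  moreover have "bounded_linear (\<lambda>x. \<Sum>b\<in>B. inner x b *\<^sub>R f b)"
    by (intro bounded_linear_sum bounded_linear_scaleR_const bounded_linear_inner_left)
  ultimately show ?thesis by simp
qed

text \<open>Coordinates of a Cauchy sequence are real Cauchy sequences. Completeness is what the
  Banach fixed point theorem asks for below.\<close>

lemma complete_model_space: "complete (UNIV :: 'a::model_space set)"
  unfolding complete_def
proof (intro allI impI)
  fix X :: "nat \<Rightarrow> 'a" assume X: "(\<forall>n. X n \<in> UNIV) \<and> Cauchy X"
  obtain B :: "'a set" where "finite B" and B: "\<And>x. x = (\<Sum>b\<in>B. inner x b *\<^sub>R b)"
    using model_space_basis by blast
  have "convergent (\<lambda>n. inner (X n) b)" for b
    using bounded_linear.Cauchy[OF bounded_linear_inner_left] X Cauchy_convergent_iff by blast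
  then have "(\<lambda>n. inner (X n) b) \<longlonglongrightarrow> lim (\<lambda>n. inner (X n) b)" for b
    by (simp add: convergent_LIMSEQ_iff)
  then have "(\<lambda>n. \<Sum>b\<in>B. inner (X n) b *\<^sub>R b) \<longlonglongrightarrow> (\<Sum>b\<in>B. lim (\<lambda>n. inner (X n) b) *\<^sub>R b)"
    by (intro tendsto_intros)
  then show "\<exists>l\<in>UNIV. X \<longlonglongrightarrow> l"
    using B by auto
qed

section \<open>Maps of class C^k on open sets\<close>

lemma Ck_on_cong:
  assumes "open S" "\<And>x. x \<in> S \<Longrightarrow> f x = g x"
  shows "Ck_on k f S \<longleftrightarrow> Ck_on k g S"
  using assms(2)
proof (induction k arbitrary: f g)
  case 0
  then show ?case by (simp cong: continuous_on_cong)
next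
  case (Suc k)
  have D: "(f has_derivative D) (at x) \<longleftrightarrow> (g has_derivative D) (at x)" if "x \<in> S" for x D
    using has_derivative_transform_within_open[OF _ assms(1) that, of f D UNIV g]
      has_derivative_transform_within_open[OF _ assms(1) that, of g D UNIV f] Suc.prems by auto
  \<comment> \<open>The two choices agree because they are made from the same predicate.\<close>
  then have F: "frechet_derivative f (at x) = frechet_derivative g (at x)" if "x \<in> S" for x
    using that by (simp add: frechet_derivative_def)
  have "Ck_on k (\<lambda>x. frechet_derivative f (at x) v) S \<longleftrightarrow> Ck_on k (\<lambda>x. frechet_derivative g (at x) v) S" for v
    by (rule Suc.IH) (simp add: F)
  moreover have "f differentiable (at x) \<longleftrightarrow> g differentiable (at x)" if "x \<in> S" for x
    using D[OF that] by (simp add: differentiable_def)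
  ultimately show ?case by auto
qed

lemma Ck_on_subset: "Ck_on k f S \<Longrightarrow> T \<subseteq> S \<Longrightarrow> Ck_on k f T"
  by (induction k arbitrary: f) (auto intro: continuous_on_subset)

lemma Ck_on_local:
  assumes "\<And>x. x \<in> S \<Longrightarrow> \<exists>U. open U \<and> x \<in> U \<and> Ck_on k f U"
  shows "Ck_on k f S"
  using assms
proof (induction k arbitrary: f)
  case 0
  show ?case
    unfolding Ck_on.simps
  proof (rule continuous_at_imp_continuous_on, intro ballI)
    fix x assume "x \<in> S"
    then obtain U where "open U" "x \<in> U" "continuous_on U f" using 0 by auto
    then show "isCont f x" by (simp add: continuous_on_eq_continuous_at)
  qed
next
  case (Suc k)
  have "Ck_on k (\<lambda>x. frechet_derivative f (at x) v) S" for v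
    by (rule Suc.IH) (metis Suc.prems Ck_on.simps(2))
  moreover have "f differentiable (at x)" if "x \<in> S" for x
    using Suc.prems[OF that] by auto
  ultimately show ?case by simp
qed

text \<open>\<open>Ck_on (Suc k)\<close> does not mention continuity of f itself; in the base case
  it comes from differentiability.\<close>

lemma Ck_on_Suc_D: "Ck_on (Suc k) f S \<Longrightarrow> Ck_on k f S"
proof (induction k arbitrary: f)
  case 0
  then show ?case
    by (auto intro!: continuous_at_imp_continuous_on differentiable_imp_continuous_within)
next
  case (Suc k)
  have "Ck_on k (\<lambda>x. frechet_derivative f (at x) v) S" for v
    by (rule Suc.IH) (use Suc.prems in simp)
  moreover have "\<forall>x\<in>S. f differentiable (at x)"
    using Suc.prems by simp
  ultimately show ?case by simp
qed

text \<open>Replaces the chosen \<open>frechet_derivative\<close> by an explicit formula D, on which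
  the induction hypothesis can be applied.\<close>

lemma Ck_on_SucI:
  assumes "open S" "\<And>x. x \<in> S \<Longrightarrow> (f has_derivative D x) (at x)" "\<And>v. Ck_on k (\<lambda>x. D x v) S"
  shows "Ck_on (Suc k) f S"
proof -
  have "Ck_on k (\<lambda>x. frechet_derivative f (at x) v) S \<longleftrightarrow> Ck_on k (\<lambda>x. D x v) S" for v
    by (rule Ck_on_cong[OF assms(1)]) (simp add: frechet_derivative_at[OF assms(2), symmetric])
  then show ?thesis
    using assms by (auto simp: differentiable_def)
qed

lemma Ck_on_Suc_derivative:
  "Ck_on (Suc k) f S \<Longrightarrow> x \<in> S \<Longrightarrow> (f has_derivative frechet_derivative f (at x)) (at x)"
  by (simp add: frechet_derivative_works)

lemma Ck_on_const:
  assumes "open S"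
  shows "Ck_on k (\<lambda>x. c) S"
proof (induction k arbitrary: c)
  case (Suc k)
  show ?case
    by (rule Ck_on_SucI[OF assms has_derivative_const Suc.IH])
qed simp

lemma Ck_on_bounded_linear:
  assumes "open S" "bounded_linear L"
  shows "Ck_on k f S \<Longrightarrow> Ck_on k (\<lambda>x. L (f x)) S"
proof (induction k arbitrary: f)
  case 0
  then show ?case
    by (simp add: bounded_linear.continuous_on[OF assms(2)])
next
  case (Suc k)
  show ?case
    by (rule Ck_on_SucI[OF assms(1), where D = "\<lambda>x v. L (frechet_derivative f (at x) v)"])
      (use Suc in \<open>auto intro!: bounded_linear.has_derivative[OF assms(2)] simp: frechet_derivative_works\<close>)
qed

lemma Ck_on_add:
  assumes "open S"
  shows "Ck_on k f S \<Longrightarrow> Ck_on k g S \<Longrightarrow> Ck_on k (\<lambda>x. f x + g x) S"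
proof (induction k arbitrary: f g)
  case 0
  then show ?case by (simp add: continuous_on_add)
next
  case (Suc k)
  show ?case
    by (rule Ck_on_SucI[OF assms, where D = "\<lambda>x v. frechet_derivative f (at x) v + frechet_derivative g (at x) v"])
      (use Suc in \<open>auto intro!: has_derivative_add simp: frechet_derivative_works\<close>)
qed

lemma Ck_on_sum:
  assumes "open S" "\<And>i. i \<in> I \<Longrightarrow> Ck_on k (f i) S"
  shows "Ck_on k (\<lambda>x. \<Sum>i\<in>I. f i x) S"
  using assms(2)
proof (induction I rule: infinite_finite_induct)
  case (insert i I)
  then show ?case by (simp add: Ck_on_add[OF assms(1)])
qed (simp_all add: Ck_on_const[OF assms(1)])

lemma Ck_on_scaleR:
  fixes f :: "'a::real_normed_vector \<Rightarrow> real"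
  assumes "open S"
  shows "Ck_on k f S \<Longrightarrow> Ck_on k g S \<Longrightarrow> Ck_on k (\<lambda>x. f x *\<^sub>R g x) S"
proof (induction k arbitrary: f g)
  case 0
  then show ?case by (simp add: continuous_on_scaleR)
next
  case (Suc k)
  show ?case
  proof (rule Ck_on_SucI[OF assms, where D = "\<lambda>x v. f x *\<^sub>R frechet_derivative g (at x) v + frechet_derivative f (at x) v *\<^sub>R g x"])
    show "((\<lambda>x. f x *\<^sub>R g x) has_derivative
        (\<lambda>v. f x *\<^sub>R frechet_derivative g (at x) v + frechet_derivative f (at x) v *\<^sub>R g x)) (at x)" if "x \<in> S" for x
      using Suc.prems that by (intro has_derivative_scaleR Ck_on_Suc_derivative)
    show "Ck_on k (\<lambda>x. f x *\<^sub>R frechet_derivative g (at x) v + frechet_derivative f (at x) v *\<^sub>R g x) S" for v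
      by (intro Ck_on_add[OF assms] Suc.IH) (use Suc.prems Ck_on_Suc_D in auto)
  qed
qed

text \<open>The chain rule differentiates f in a direction that varies with x, while
  \<open>Ck_on\<close> speaks of fixed directions only. Expanding the direction in a basis of the
  middle space leaves sums of products, with f differentiated in fixed directions.\<close>

lemma Ck_on_compose:
  fixes g :: "'a::real_normed_vector \<Rightarrow> 'b::model_space" and f :: "'b \<Rightarrow> 'c::real_normed_vector"
  assumes "open S" "g ` S \<subseteq> T"
  shows "Ck_on k g S \<Longrightarrow> Ck_on k f T \<Longrightarrow> Ck_on k (\<lambda>x. f (g x)) S"
proof (induction k arbitrary: f)
  case 0
  then show ?case
    using continuous_on_compose2 assms(2) by (metis Ck_on.simps(1))
next
  case (Suc k)
  obtain B :: "'b set" where "finite B" and B: "\<And>x. x = (\<Sum>b\<in>B. inner x b *\<^sub>R b)"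
    using model_space_basis by blast
  let ?D = "\<lambda>x v. \<Sum>b\<in>B. inner (frechet_derivative g (at x) v) b *\<^sub>R frechet_derivative f (at (g x)) b"
  show ?case
  proof (rule Ck_on_SucI[OF assms(1), where D = ?D])
    show "((\<lambda>x. f (g x)) has_derivative ?D x) (at x)" if "x \<in> S" for x
    proof -
      have f: "(f has_derivative frechet_derivative f (at (g x))) (at (g x))"
        using Suc.prems(2) that assms(2) by (intro Ck_on_Suc_derivative) auto
      have g: "(g has_derivative frechet_derivative g (at x)) (at x)"
        using Suc.prems(1) that by (intro Ck_on_Suc_derivative)
      have "((\<lambda>x. f (g x)) has_derivative (\<lambda>v. frechet_derivative f (at (g x)) (frechet_derivative g (at x) v))) (at x)"
        using diff_chain_at[OF g f] by (simp add: o_def)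
      moreover have "(\<lambda>v. frechet_derivative f (at (g x)) (frechet_derivative g (at x) v)) = ?D x"
        by (rule ext) (rule linear_basis_expansion[OF has_derivative_linear[OF f] B])
      ultimately show ?thesis by metis
    qed
    show "Ck_on k (\<lambda>x. ?D x v) S" for v
    proof (intro Ck_on_sum Ck_on_scaleR assms(1) Ck_on_bounded_linear[OF assms(1) bounded_linear_inner_left])
      show "Ck_on k (\<lambda>x. frechet_derivative g (at x) v) S"
        using Suc.prems(1) by simp
      show "Ck_on k (\<lambda>x. frechet_derivative f (at (g x)) b) S" for b
        by (rule Suc.IH[where f = "\<lambda>y. frechet_derivative f (at y) b"]) (use Suc.prems Ck_on_Suc_D in auto)
    qed
  qed
qed

lemma Ck_on_id:
  assumes "open S"
  shows "Ck_on k (\<lambda>x. x) S"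
proof (cases k)
  case (Suc n)
  show ?thesis
    unfolding Suc by (rule Ck_on_SucI[OF assms has_derivative_ident]) (rule Ck_on_const[OF assms])
qed simp

section \<open>Smooth maps on open sets\<close>

lemma smooth_on_cong: "open S \<Longrightarrow> (\<And>x. x \<in> S \<Longrightarrow> f x = g x) \<Longrightarrow> smooth_on S f \<longleftrightarrow> smooth_on S g"
  unfolding smooth_on_def using Ck_on_cong by blast

lemma smooth_on_subset: "smooth_on S f \<Longrightarrow> T \<subseteq> S \<Longrightarrow> smooth_on T f"
  unfolding smooth_on_def using Ck_on_subset by blast

lemma smooth_on_local:
  assumes "\<And>x. x \<in> S \<Longrightarrow> \<exists>U. open U \<and> x \<in> U \<and> smooth_on U f"
  shows "smooth_on S f"
  unfolding smooth_on_def
  by (intro allI Ck_on_local) (use assms in \<open>auto simp: smooth_on_def\<close>)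

lemma smooth_on_compose:
  fixes g :: "'a::real_normed_vector \<Rightarrow> 'b::model_space" and f :: "'b \<Rightarrow> 'c::real_normed_vector"
  shows "open S \<Longrightarrow> g ` S \<subseteq> T \<Longrightarrow> smooth_on S g \<Longrightarrow> smooth_on T f \<Longrightarrow> smooth_on S (\<lambda>x. f (g x))"
  unfolding smooth_on_def using Ck_on_compose by blast

lemma smooth_on_bounded_linear: "open S \<Longrightarrow> bounded_linear L \<Longrightarrow> smooth_on S f \<Longrightarrow> smooth_on S (\<lambda>x. L (f x))"
  unfolding smooth_on_def using Ck_on_bounded_linear by blast

lemma smooth_on_const: "open S \<Longrightarrow> smooth_on S (\<lambda>x. c)"
  unfolding smooth_on_def using Ck_on_const by blast

lemma smooth_on_id: "open S \<Longrightarrow> smooth_on S (\<lambda>x. x)"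
  unfolding smooth_on_def using Ck_on_id by blast

lemma smooth_on_diff: "open S \<Longrightarrow> smooth_on S f \<Longrightarrow> smooth_on S g \<Longrightarrow> smooth_on S (\<lambda>x. f x - g x)"
  using Ck_on_add[of S _ f "\<lambda>x. - g x"] smooth_on_bounded_linear[OF _ bounded_linear_minus[OF bounded_linear_ident], of S g]
  unfolding smooth_on_def by simp

lemma smooth_on_Pair:
  assumes "open S" "smooth_on S f" "smooth_on S g"
  shows "smooth_on S (\<lambda>x. (f x, g x))"
proof -
  have "bounded_linear (\<lambda>a::'b. (a, 0::'c))"
    by (intro bounded_linear_Pair bounded_linear_ident bounded_linear_zero)
  from smooth_on_bounded_linear[OF assms(1) this assms(2)]
  have 1: "smooth_on S (\<lambda>x. (f x, 0::'c))" .
  have "bounded_linear (\<lambda>b::'c. (0::'b, b))"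
    by (intro bounded_linear_Pair bounded_linear_ident bounded_linear_zero)
  from smooth_on_bounded_linear[OF assms(1) this assms(3)]
  have 2: "smooth_on S (\<lambda>x. (0::'b, g x))" .
  show ?thesis
    using Ck_on_add[OF assms(1), of _ "\<lambda>x. (f x, 0)" "\<lambda>x. (0, g x)"] 1 2 by (simp add: smooth_on_def)
qed

lemma smooth_on_derivative:
  assumes "smooth_on S f" "x \<in> S"
  shows "(f has_derivative frechet_derivative f (at x)) (at x)"
  using assms(1)[unfolded smooth_on_def, rule_format, of "Suc 0"] Ck_on_Suc_derivative[OF _ assms(2)] by blast

lemma smooth_on_continuous_derivative:
  assumes "smooth_on S f"
  shows "continuous_on S (\<lambda>x. frechet_derivative f (at x) v)"
  using assms[unfolded smooth_on_def, rule_format, of "Suc 0"] by simp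

section \<open>Curves in the zero set of a submersion\<close>

text \<open>Continuity of the finitely many partial derivatives makes the derivative vary by at most
  e in operator norm on a small ball; the mean value inequality then compares any two points of the
  ball, not only points with x.\<close>

lemma smooth_on_strict_derivative:
  fixes f :: "'a::model_space \<Rightarrow> 'b::real_normed_vector"
  assumes "smooth_on U f" "open U" "x \<in> U" "0 < e"
  obtains r where "0 < r" "cball x r \<subseteq> U"
    "\<And>y z. y \<in> cball x r \<Longrightarrow> z \<in> cball x r \<Longrightarrow>
      norm (f y - f z - frechet_derivative f (at x) (y - z)) \<le> e * norm (y - z)"
proof -
  let ?D = "\<lambda>y. frechet_derivative f (at y)"
  obtain B :: "'a set" where fB: "finite B" and B: "\<And>x. x = (\<Sum>b\<in>B. inner x b *\<^sub>R b)"
    using model_space_basis by blast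
  have D: "(f has_derivative ?D y) (at y)" if "y \<in> U" for y
    using smooth_on_derivative[OF assms(1) that] .
  \<comment> \<open>M distributes the tolerance e over the basis; the summand 1 keeps it positive
    when the basis is empty.\<close>
  define M where "M = (\<Sum>b\<in>B. norm b) + 1"
  have M: "M > 0" unfolding M_def by (simp add: sum_nonneg add_nonneg_pos)
  have "\<forall>\<^sub>F y in at x. norm (?D y b - ?D x b) < e / M" for b
  proof -
    have "isCont (\<lambda>y. ?D y b) x"
      using smooth_on_continuous_derivative[OF assms(1)] assms(2,3) by (simp add: continuous_on_eq_continuous_at)
    then show ?thesis
      using tendstoD[of "\<lambda>y. ?D y b" "?D x b" "at x" "e / M"] assms(4) M
      by (simp add: isCont_def dist_norm)
  qed
  then have "\<forall>\<^sub>F y in at x. \<forall>b\<in>B. norm (?D y b - ?D x b) < e / M"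
    using fB by (simp add: eventually_ball_finite)
  then obtain r1 where r1: "r1 > 0" "\<And>y. y \<noteq> x \<Longrightarrow> dist y x < r1 \<Longrightarrow> \<forall>b\<in>B. norm (?D y b - ?D x b) < e / M"
    unfolding eventually_at by auto
  obtain r2 where r2: "r2 > 0" "cball x r2 \<subseteq> U"
    using assms(2,3) open_contains_cball by blast
  define r where "r = min (r1 / 2) r2"
  have r: "0 < r" "cball x r \<subseteq> U" "r < r1"
    using r1(1) r2 by (auto simp: r_def)
  have bound: "norm (?D y h - ?D x h) \<le> e * norm h" if "y \<in> cball x r" for y h
  proof -
    have y: "norm (?D y b - ?D x b) \<le> e / M" if "b \<in> B" for b
      using r1(2)[of y] \<open>y \<in> cball x r\<close> that r(3) assms(4) M
      by (cases "y = x") (auto simp: dist_commute intro: less_imp_le)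
    have "?D y h - ?D x h = (\<Sum>b\<in>B. inner h b *\<^sub>R ?D y b) - (\<Sum>b\<in>B. inner h b *\<^sub>R ?D x b)"
      using linear_basis_expansion[OF has_derivative_linear[OF D] B, of y h]
        linear_basis_expansion[OF has_derivative_linear[OF D] B, of x h] that r(2) assms(3) by auto
    also have "\<dots> = (\<Sum>b\<in>B. inner h b *\<^sub>R (?D y b - ?D x b))"
      by (simp add: scaleR_diff_right sum_subtractf)
    also have "norm \<dots> \<le> (\<Sum>b\<in>B. (norm h * norm b) * (e / M))"
    proof (rule sum_norm_le)
      fix b assume "b \<in> B"
      show "norm (inner h b *\<^sub>R (?D y b - ?D x b)) \<le> (norm h * norm b) * (e / M)"
        unfolding norm_scaleR
        by (intro mult_mono Cauchy_Schwarz_ineq2 y \<open>b \<in> B\<close>) auto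
    qed
    also have "\<dots> = norm h * (e / M) * (\<Sum>b\<in>B. norm b)"
      by (simp only: sum_distrib_right[symmetric] sum_distrib_left[symmetric] mult_ac)
    also have "\<dots> \<le> norm h * (e / M) * M"
      using assms(4) M by (intro mult_left_mono) (auto simp: M_def)
    also have "\<dots> = e * norm h"
      using M by simp
    finally show ?thesis .
  qed
  have "norm (f y - f z - ?D x (y - z)) \<le> e * norm (y - z)" if yz: "y \<in> cball x r" "z \<in> cball x r" for y z
  proof -
    have lin: "linear (?D x)"
      using has_derivative_linear[OF D[OF assms(3)]] .
    \<comment> \<open>Subtracting the derivative at x leaves a map whose own derivative is bounded
      by e on the ball.\<close>
    let ?g = "\<lambda>y. f y - ?D x y"
    have "norm (?g y - ?g z) \<le> e * norm (y - z)"
    proof (rule differentiable_bound[OF convex_cball[of x r] _ _ yz, where f' = "\<lambda>y h. ?D y h - ?D x h"])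
      fix y assume y: "y \<in> cball x r"
      show "(?g has_derivative (\<lambda>h. ?D y h - ?D x h)) (at y within cball x r)"
        using y r(2) by (intro has_derivative_diff has_derivative_at_withinI[OF D] bounded_linear_imp_has_derivative
            linear_bounded_linear lin) auto
      show "onorm (\<lambda>h. ?D y h - ?D x h) \<le> e"
        by (rule onorm_bound) (use bound[OF y] assms(4) in auto)
    qed
    then show ?thesis
      by (simp add: linear_diff[OF lin] algebra_simps)
  qed
  then show thesis using that r by blast
qed

text \<open>The implicit function theorem along one direction. With a linear right inverse \<open>R\<close> of the
  derivative \<open>D\<close>, the zero \<open>y t\<close> of \<open>f\<close> is the fixed point of the contraction
  \<open>z \<mapsto> x + t v - R (f z - D (z - x))\<close>.\<close>

lemma implicit_curve:
  fixes f :: "'a::model_space \<Rightarrow> 'b::model_space"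
  assumes "smooth_on U f" "open U" "x \<in> U" "f x = 0"
    and surj: "surj (frechet_derivative f (at x))" and v: "frechet_derivative f (at x) v = 0"
  obtains y :: "real \<Rightarrow> 'a" where "y 0 = x" "(y has_vector_derivative v) (at 0)"
    "\<forall>\<^sub>F t in at 0. f (y t) = 0"
proof -
  let ?D = "frechet_derivative f (at x)"
  have lin: "linear ?D"
    using has_derivative_linear[OF smooth_on_derivative[OF assms(1,3)]] .
  obtain R where R: "linear R" "?D \<circ> R = id"
    using linear_surjective_right_inverse[OF lin surj] by auto
  obtain K where K: "K > 0" "\<And>w. norm (R w) \<le> norm w * K"
    using bounded_linear.pos_bounded[OF linear_bounded_linear[OF R(1)]] by blast
  \<comment> \<open>As f x = 0, this is R applied to the first-order remainder of f at x. Its strict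
    derivative at x is 0, so its Lipschitz constant near x is as small as desired.\<close>
  define E where "E z = R (f z - ?D (z - x))" for z
  have Ediff: "E y - E z = R (f y - f z - ?D (y - z))" for y z
    by (simp add: E_def linear_diff[OF R(1), symmetric] linear_diff[OF lin] algebra_simps)
  have Ex: "E x = 0"
    by (simp add: E_def assms(4) linear_0[OF lin] linear_0[OF R(1)])
  have strict: "\<exists>r>0. \<forall>y\<in>cball x r. \<forall>z\<in>cball x r. norm (E y - E z) \<le> e * norm (y - z)" if e: "e > 0" for e
  proof -
    \<comment> \<open>R stretches norms by at most K, hence the tolerance e / K.\<close>
    obtain r where r: "0 < r" "\<And>y z. y \<in> cball x r \<Longrightarrow> z \<in> cball x r \<Longrightarrow>
        norm (f y - f z - ?D (y - z)) \<le> e / K * norm (y - z)"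
      by (rule smooth_on_strict_derivative[OF assms(1-3), of "e / K"]) (use e K(1) in auto)
    have "norm (E y - E z) \<le> e * norm (y - z)" if "y \<in> cball x r" "z \<in> cball x r" for y z
    proof -
      have "norm (E y - E z) \<le> norm (f y - f z - ?D (y - z)) * K"
        unfolding Ediff by (rule K(2))
      also have "\<dots> \<le> e / K * norm (y - z) * K"
        using r(2)[OF that] K(1) by (intro mult_right_mono) auto
      finally show ?thesis using K(1) by simp
    qed
    then show ?thesis using r(1) by blast
  qed
  obtain r where r: "r > 0" "\<And>y z. y \<in> cball x r \<Longrightarrow> z \<in> cball x r \<Longrightarrow> norm (E y - E z) \<le> 1/2 * norm (y - z)"
    using strict[of "1/2"] by auto
  \<comment> \<open>Lipschitz constant 1/2 and E x = 0 bound E by r / 2 on the ball; the other half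
    of the radius is left for the displacement t v.\<close>
  have small: "\<exists>z\<in>cball x r. x + t *\<^sub>R v - E z = z" if t: "norm (t *\<^sub>R v) \<le> r / 2" for t
  proof -
    have "\<exists>!z\<in>cball x r. x + t *\<^sub>R v - E z = z"
    proof (rule Banach_fix[where c = "1/2"])
      show "complete (cball x r)"
        using complete_Int_closed[OF complete_model_space closed_cball, of x r] by simp
      show "(\<lambda>z. x + t *\<^sub>R v - E z) ` cball x r \<subseteq> cball x r"
      proof (rule image_subsetI)
        fix z assume z: "z \<in> cball x r"
        have "norm (E z) \<le> r / 2"
          using r(2)[OF z, of x] r(1) z Ex by (simp add: dist_norm norm_minus_commute)
        then have "norm (t *\<^sub>R v - E z) \<le> r"
          using t norm_triangle_ineq4[of "t *\<^sub>R v" "E z"] by linarith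
        then show "x + t *\<^sub>R v - E z \<in> cball x r"
          by (simp add: dist_norm norm_minus_commute)
      qed
      show "dist (x + t *\<^sub>R v - E y) (x + t *\<^sub>R v - E z) \<le> 1/2 * dist y z"
        if "y \<in> cball x r" "z \<in> cball x r" for y z
        using r(2)[OF that] by (simp add: dist_norm norm_minus_commute)
    qed (use r(1) in auto)
    then show ?thesis by blast
  qed
  \<comment> \<open>For large t the value is arbitrary; only times near 0 matter.\<close>
  define y where "y t = (SOME z. z \<in> cball x r \<and> x + t *\<^sub>R v - E z = z)" for t
  have y: "y t \<in> cball x r" "x + t *\<^sub>R v - E (y t) = y t" if "norm (t *\<^sub>R v) \<le> r / 2" for t
    unfolding y_def using someI_ex[OF small[OF that, unfolded Bex_def]] by auto
  \<comment> \<open>The fixed point equation gives |y t - x| \<le> |t v| + |y t - x| / 2, and the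
    last term is absorbed.\<close>
  have near: "norm (y t - x) \<le> 2 * norm (t *\<^sub>R v)" if "norm (t *\<^sub>R v) \<le> r / 2" for t
  proof -
    have "norm (E (y t)) \<le> 1/2 * norm (y t - x)"
      using r(2)[OF y(1)[OF that], of x] r(1) Ex by simp
    moreover have "y t - x = t *\<^sub>R v - E (y t)"
      using y(2)[OF that] by (metis add_diff_cancel_left' add_diff_eq)
    ultimately show ?thesis
      using norm_triangle_ineq4[of "t *\<^sub>R v" "E (y t)"] by simp
  qed
  have "((\<lambda>t. norm (t *\<^sub>R v)) \<longlongrightarrow> norm (0 *\<^sub>R v)) (at 0)"
    by (intro tendsto_intros)
  then have tv: "\<forall>\<^sub>F t in at 0. norm (t *\<^sub>R v) \<le> d" if "d > 0" for d
    using that by (auto dest!: order_tendstoD(2)[of _ _ _ d] elim!: eventually_mono)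
  have y0: "y 0 = x"
    using near[of 0] r(1) by simp
  show thesis
  proof (rule that[of y])
    show "y 0 = x" by (rule y0)
    show "(y has_vector_derivative v) (at 0)"
      unfolding has_vector_derivative_def has_derivative_at2
    proof (intro conjI tendstoI)
      show "bounded_linear (\<lambda>t. t *\<^sub>R v)" by (rule bounded_linear_scaleR_left)
      fix e :: real assume e: "e > 0"
      \<comment> \<open>With Lipschitz constant e' and \<open>near\<close>, the error E (y t) is at
        most 2 e' |t| |v|. This choice makes 2 e' |v| at most e / 2; the 1 covers v = 0.\<close>
      define e' where "e' = e / (4 * (norm v + 1))"
      have nv: "0 < 4 * (norm v + 1)"
        by (simp add: add_nonneg_pos)
      have e': "e' > 0" using e nv by (simp add: e'_def)
      obtain d where d: "d > 0" "\<And>y z. y \<in> cball x d \<Longrightarrow> z \<in> cball x d \<Longrightarrow> norm (E y - E z) \<le> e' * norm (y - z)"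
        using strict[OF e'] by blast
      have "\<forall>\<^sub>F t in at 0. norm (t *\<^sub>R v) \<le> min (r / 2) (d / 2) \<and> t \<noteq> 0"
        by (intro eventually_conj tv eventually_neq_at_within) (use r(1) d(1) in auto)
      then show "\<forall>\<^sub>F t in at 0. dist ((1 / norm (t - 0)) *\<^sub>R (y t - (y 0 + (t - 0) *\<^sub>R v))) 0 < e"
      proof (rule eventually_mono)
        fix t :: real assume "norm (t *\<^sub>R v) \<le> min (r / 2) (d / 2) \<and> t \<noteq> 0"
        then have t: "norm (t *\<^sub>R v) \<le> r / 2" "norm (t *\<^sub>R v) \<le> d / 2" "t \<noteq> 0" by auto
        have "norm (y t - x) \<le> d" using near[OF t(1)] t(2) by linarith
        then have "norm (E (y t)) \<le> e' * norm (y t - x)"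
          using d(2)[of "y t" x] d(1) Ex by (simp add: dist_norm norm_minus_commute)
        also have "\<dots> \<le> e' * (2 * norm (t *\<^sub>R v))"
          using near[OF t(1)] e' by (intro mult_left_mono) auto
        also have "\<dots> = \<bar>t\<bar> * (2 * e' * norm v)" by simp
        also have "2 * e' * norm v < e"
        proof -
          have "2 * e' * norm v \<le> 2 * e' * (norm v + 1)" using e' by simp
          also have "\<dots> = e / 2" using nv by (simp add: e'_def divide_simps)
          finally show ?thesis using e by linarith
        qed
        finally have "norm (E (y t)) < \<bar>t\<bar> * e" using t(3) by simp
        moreover have "y t - (x + t *\<^sub>R v) = - E (y t)"
          using y(2)[OF t(1)] by (metis add_diff_cancel_left' minus_diff_eq add_diff_eq diff_add_cancel)
        ultimately show "dist ((1 / norm (t - 0)) *\<^sub>R (y t - (y 0 + (t - 0) *\<^sub>R v))) 0 < e"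
          using t(3) by (simp add: y0 divide_simps mult.commute)
      qed
    qed
    show "\<forall>\<^sub>F t in at 0. f (y t) = 0"
    proof (rule eventually_mono[OF tv[of "r / 2"]])
      fix t :: real assume t: "norm (t *\<^sub>R v) \<le> r / 2"
      have "y t - x = t *\<^sub>R v - E (y t)"
        using y(2)[OF t] by (metis add_diff_cancel_left' add_diff_eq)
      \<comment> \<open>Apply D to the fixed point equation. Since D v = 0 and D R = id, the terms D
        (y t - x) cancel and only f (y t) = 0 remains.\<close>
      then have "?D (y t - x) = - ?D (E (y t))"
        by (simp add: linear_diff[OF lin] linear_scale[OF lin] v)
      also have "\<dots> = - (f (y t) - ?D (y t - x))"
        using R(2) by (simp add: E_def fun_eq_iff)
      finally show "f (y t) = 0" by simp
    qed (use r(1) in auto)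
  qed
qed

section \<open>Smooth maps between manifolds\<close>

lemma smooth_manifold_chart_at:
  "smooth_manifold N \<Longrightarrow> chart_at N p \<in> charts N" "smooth_manifold N \<Longrightarrow> p \<in> fst (chart_at N p)"
  by (simp_all add: smooth_manifold_def)

context
  fixes N :: "('a::{t2_space, second_countable_topology}, 'e::model_space) manifold" and c :: "('a, 'e) chart"
  assumes N: "smooth_manifold N" and c: "c \<in> charts N"
begin

lemma chart_homeomorphism: "homeomorphism (fst c) (snd c ` fst c) (snd c) (chart_inv c)"
  using N c by (simp add: smooth_manifold_def)

lemma open_chart_domain: "open (fst c)"
  using N c by (simp add: smooth_manifold_def)

lemma open_chart_image: "open (snd c ` fst c)"
  using N c by (simp add: smooth_manifold_def)

lemma chart_inv_chart [simp]: "p \<in> fst c \<Longrightarrow> chart_inv c (snd c p) = p"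
  using chart_homeomorphism by (simp add: homeomorphism_def)

lemma inj_on_chart: "inj_on (snd c) (fst c)"
  using chart_inv_chart by (rule inj_on_inverseI)

lemma continuous_on_chart: "continuous_on (fst c) (snd c)"
  using chart_homeomorphism by (simp add: homeomorphism_def)

lemma continuous_on_chart_inv: "continuous_on (snd c ` fst c) (chart_inv c)"
  using chart_homeomorphism by (simp add: homeomorphism_def)

lemma open_chart_image_Int:
  assumes "open W"
  shows "open (snd c ` (fst c \<inter> W))"
proof -
  have "snd c ` (fst c \<inter> W) = snd c ` fst c \<inter> chart_inv c -` W"
    by (auto intro: rev_image_eqI)
  then show ?thesis
    using continuous_open_preimage[OF continuous_on_chart_inv open_chart_image assms] by simp
qed

lemma open_image_preimage:
  assumes "open W" "continuous_on W f" "open V"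
  shows "open (snd c ` (W \<inter> fst c \<inter> f -` V))"
proof -
  have "open (W \<inter> f -` V)"
    using continuous_open_preimage[OF assms(2,1,3)] .
  then show ?thesis
    using open_chart_image_Int[of "W \<inter> f -` V"] by (simp add: Int_ac)
qed

end

lemma smooth_map_on_chart:
  assumes "smooth_manifold N" "smooth_manifold Q" "open W" "smooth_map_on N Q W f" "c \<in> charts N" "d \<in> charts Q"
  shows "open (snd c ` (W \<inter> fst c \<inter> f -` fst d))"
    "smooth_on (snd c ` (W \<inter> fst c \<inter> f -` fst d)) (\<lambda>x. snd d (f (chart_inv c x)))"
  using assms open_image_preimage[of N c W f "fst d"] open_chart_domain[of Q d]
  by (auto simp: smooth_map_on_def o_def)

lemma smooth_map_on_compose:
  fixes f :: "'a::{t2_space, second_countable_topology} \<Rightarrow> 'b::{t2_space, second_countable_topology}"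
    and g :: "'b \<Rightarrow> 'c::{t2_space, second_countable_topology}"
  assumes M: "smooth_manifold N" "smooth_manifold Q" "smooth_manifold R"
    and W: "open W" "open V" "f ` W \<subseteq> V"
    and f: "smooth_map_on N Q W f" and g: "smooth_map_on Q R V g"
  shows "smooth_map_on N R W (\<lambda>x. g (f x))"
  unfolding smooth_map_on_def
proof (intro conjI ballI)
  have cf: "continuous_on W f" and cg: "continuous_on V g"
    using f g by (auto simp: smooth_map_on_def)
  show cgf: "continuous_on W (\<lambda>x. g (f x))"
    using continuous_on_compose2[OF cg cf W(3)] .
  fix c e assume c: "c \<in> charts N" and e: "e \<in> charts R"
  show "smooth_on (snd c ` (W \<inter> fst c \<inter> (\<lambda>x. g (f x)) -` fst e)) (snd e \<circ> (\<lambda>x. g (f x)) \<circ> chart_inv c)"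
  proof (rule smooth_on_local)
    fix x assume "x \<in> snd c ` (W \<inter> fst c \<inter> (\<lambda>x. g (f x)) -` fst e)"
    then obtain p where p: "x = snd c p" "p \<in> W" "p \<in> fst c" "g (f p) \<in> fst e" by auto
    \<comment> \<open>Smoothness is local, so near p the composite may be factored through a chart
      around f p.\<close>
    define d where "d = chart_at Q (f p)"
    have d: "d \<in> charts Q" "f p \<in> fst d"
      using smooth_manifold_chart_at[OF M(2)] by (auto simp: d_def)
    let ?U = "snd c ` (W \<inter> fst c \<inter> (\<lambda>x. (f x, g (f x))) -` (fst d \<times> fst e))"
    have U: "open ?U"
      using open_image_preimage[OF M(1) c W(1), of "\<lambda>x. (f x, g (f x))" "fst d \<times> fst e"]
        open_chart_domain[OF M(2) d(1)] open_chart_domain[OF M(3) e] cf cgf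
      by (simp add: open_Times continuous_on_Pair)
    have "smooth_on ?U (\<lambda>x. snd e (g (chart_inv d (snd d (f (chart_inv c x))))))"
    proof (rule smooth_on_compose[OF U, where g = "\<lambda>x. snd d (f (chart_inv c x))" and f = "\<lambda>y. snd e (g (chart_inv d y))"])
      show "smooth_on ?U (\<lambda>x. snd d (f (chart_inv c x)))"
        by (rule smooth_on_subset[OF smooth_map_on_chart(2)[OF M(1,2) W(1) f c d(1)]]) auto
      show "smooth_on (snd d ` (V \<inter> fst d \<inter> g -` fst e)) (\<lambda>y. snd e (g (chart_inv d y)))"
        by (rule smooth_map_on_chart(2)[OF M(2,3) W(2) g d(1) e])
      show "(\<lambda>x. snd d (f (chart_inv c x))) ` ?U \<subseteq> snd d ` (V \<inter> fst d \<inter> g -` fst e)"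
        using W(3) chart_inv_chart[OF M(1) c] by auto
    qed
    then have "smooth_on ?U (snd e \<circ> (\<lambda>x. g (f x)) \<circ> chart_inv c)"
      by (subst smooth_on_cong[OF U, of _ "\<lambda>x. snd e (g (chart_inv d (snd d (f (chart_inv c x)))))"])
        (auto simp: chart_inv_chart[OF M(1) c] chart_inv_chart[OF M(2) d(1)])
    moreover have "x \<in> ?U" using p d(2) by auto
    ultimately show "\<exists>U. open U \<and> x \<in> U \<and> smooth_on U (snd e \<circ> (\<lambda>x. g (f x)) \<circ> chart_inv c)"
      using U by blast
  qed
qed

lemma smooth_map_const:
  assumes "smooth_manifold N"
  shows "smooth_map N Q (\<lambda>x. q)"
  unfolding smooth_map_on_def
proof (intro conjI ballI)
  fix c d assume c: "c \<in> charts N"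
  show "smooth_on (snd c ` (UNIV \<inter> fst c \<inter> (\<lambda>x. q) -` fst d)) (snd d \<circ> (\<lambda>x. q) \<circ> chart_inv c)"
    \<comment> \<open>If q lies outside the chart d, the domain is empty.\<close>
    using open_chart_image[OF assms c] smooth_on_const by (cases "q \<in> fst d") (auto simp: o_def)
qed simp

lemma smooth_map_id:
  assumes "smooth_manifold N"
  shows "smooth_map N N (\<lambda>x. x)"
  using assms by (auto simp: smooth_map_on_def smooth_manifold_def o_def vimage_def)

section \<open>Product manifolds\<close>

lemma charts_prod_manifold:
  "C \<in> charts (prod_manifold N Q) \<longleftrightarrow> (\<exists>c\<in>charts N. \<exists>d\<in>charts Q. C = prod_chart c d)"
  by (auto simp: prod_manifold_def)

lemma chart_at_prod_manifold: "chart_at (prod_manifold N Q) (p, q) = prod_chart (chart_at N p) (chart_at Q q)"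
  by (simp add: prod_manifold_def)

lemma prod_chart_simps [simp]:
  "fst (prod_chart c d) = fst c \<times> fst d" "snd (prod_chart c d) (p, q) = (snd c p, snd d q)"
  by (simp_all add: prod_chart_def)

lemma chart_inv_prod_chart:
  assumes "smooth_manifold N" "smooth_manifold Q" "c \<in> charts N" "d \<in> charts Q" "p \<in> fst c" "q \<in> fst d"
  shows "chart_inv (prod_chart c d) (snd c p, snd d q) = (p, q)"
proof -
  have "inj_on (snd (prod_chart c d)) (fst c \<times> fst d)"
    unfolding prod_chart_def snd_conv
    by (intro map_prod_inj_on inj_on_chart[OF assms(1,3)] inj_on_chart[OF assms(2,4)])
  from inv_into_f_f[OF this, of "(p, q)"] show ?thesis
    using assms(5,6) by (simp add: chart_inv_def)
qed

lemma image_prod_chart: "snd (prod_chart c d) ` (S \<times> T) = (snd c ` S) \<times> (snd d ` T)"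
  by (auto simp: prod_chart_def)

lemma smooth_manifold_prod:
  fixes N :: "('a::{t2_space, second_countable_topology}, 'e::model_space) manifold"
    and Q :: "('b::{t2_space, second_countable_topology}, 'f::model_space) manifold"
  assumes N: "smooth_manifold N" and Q: "smooth_manifold Q"
  shows "smooth_manifold (prod_manifold N Q)"
  unfolding smooth_manifold_def
proof (intro conjI allI ballI)
  fix p :: "'a \<times> 'b"
  show "chart_at (prod_manifold N Q) p \<in> charts (prod_manifold N Q)"
    using smooth_manifold_chart_at(1)[OF N] smooth_manifold_chart_at(1)[OF Q]
    by (cases p) (auto simp: charts_prod_manifold chart_at_prod_manifold)
  show "p \<in> fst (chart_at (prod_manifold N Q) p)"
    by (cases p) (auto simp: chart_at_prod_manifold smooth_manifold_chart_at N Q)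
next
  fix C assume "C \<in> charts (prod_manifold N Q)"
  then obtain c d where c: "c \<in> charts N" and d: "d \<in> charts Q" and C: "C = prod_chart c d"
    by (auto simp: charts_prod_manifold)
  note open_chart_domain[OF N c, simp] open_chart_domain[OF Q d, simp]
    open_chart_image[OF N c, simp] open_chart_image[OF Q d, simp]
  have im: "snd C ` fst C = (snd c ` fst c) \<times> (snd d ` fst d)"
    by (simp add: C image_prod_chart)
  show "open (fst C)" by (simp add: C open_Times)
  show "open (snd C ` fst C)" by (simp add: im open_Times)
  have inv: "chart_inv C z = (chart_inv c (fst z), chart_inv d (snd z))"
    if "z \<in> snd C ` fst C" for z
    using that by (auto simp: im C chart_inv_prod_chart[OF N Q c d] chart_inv_chart[OF N c] chart_inv_chart[OF Q d])
  show "homeomorphism (fst C) (snd C ` fst C) (snd C) (chart_inv C)"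
  proof (rule homeomorphismI)
    have "continuous_on (fst c \<times> fst d) (\<lambda>p. (snd c (fst p), snd d (snd p)))"
      by (intro continuous_on_Pair continuous_on_compose2[OF continuous_on_chart[OF N c]]
          continuous_on_compose2[OF continuous_on_chart[OF Q d]] continuous_intros) auto
    then show "continuous_on (fst C) (snd C)"
      by (simp add: C prod_chart_def map_prod_def case_prod_unfold)
    have "continuous_on (snd C ` fst C) (\<lambda>p. (chart_inv c (fst p), chart_inv d (snd p)))"
      unfolding im
      by (intro continuous_on_Pair continuous_on_compose2[OF continuous_on_chart_inv[OF N c]]
          continuous_on_compose2[OF continuous_on_chart_inv[OF Q d]] continuous_intros) auto
    then show "continuous_on (snd C ` fst C) (chart_inv C)"
      by (rule continuous_on_eq) (simp add: inv)
    show "chart_inv C ` (snd C ` fst C) \<subseteq> fst C"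
      by (auto simp: C chart_inv_prod_chart[OF N Q c d])
    show "chart_inv C (snd C p) = p" if "p \<in> fst C" for p
      using that by (cases p) (auto simp: C chart_inv_prod_chart[OF N Q c d])
    then show "snd C (chart_inv C y) = y" if "y \<in> snd C ` fst C" for y
      using that by auto
  qed auto
next
  fix C C' assume "C \<in> charts (prod_manifold N Q)" "C' \<in> charts (prod_manifold N Q)"
  then obtain c d c' d' where c: "c \<in> charts N" "c' \<in> charts N" and d: "d \<in> charts Q" "d' \<in> charts Q"
    and C: "C = prod_chart c d" "C' = prod_chart c' d'"
    by (auto simp: charts_prod_manifold)
  let ?U = "snd c ` (fst c \<inter> fst c')" and ?V = "snd d ` (fst d \<inter> fst d')"
  have UV: "open (?U \<times> ?V)"
    by (intro open_Times open_chart_image_Int[OF N c(1)] open_chart_image_Int[OF Q d(1)]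
        open_chart_domain[OF N c(2)] open_chart_domain[OF Q d(2)])
  have im: "snd C ` (fst C \<inter> fst C') = ?U \<times> ?V"
    by (simp add: C image_prod_chart Times_Int_Times)
  have "smooth_on ?U (\<lambda>x. snd c' (chart_inv c x))" "smooth_on ?V (\<lambda>x. snd d' (chart_inv d x))"
    using N Q c d by (auto simp: smooth_manifold_def o_def)
  then have "smooth_on (?U \<times> ?V) (\<lambda>z. (snd c' (chart_inv c (fst z)), snd d' (chart_inv d (snd z))))"
    by (intro smooth_on_Pair UV smooth_on_compose[OF UV _ smooth_on_bounded_linear[OF UV bounded_linear_fst smooth_on_id[OF UV]]]
        smooth_on_compose[OF UV _ smooth_on_bounded_linear[OF UV bounded_linear_snd smooth_on_id[OF UV]]]) auto
  then show "smooth_on (snd C ` (fst C \<inter> fst C')) (snd C' \<circ> chart_inv C)"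
    unfolding im
    by (subst smooth_on_cong[OF UV, of _ "\<lambda>z. (snd c' (chart_inv c (fst z)), snd d' (chart_inv d (snd z)))"])
      (auto simp: C chart_inv_prod_chart[OF N Q c(1) d(1)] chart_inv_chart[OF N c(1)] chart_inv_chart[OF Q d(1)])
qed

lemma smooth_map_fst:
  fixes N :: "('a::{t2_space, second_countable_topology}, 'e::model_space) manifold"
    and Q :: "('b::{t2_space, second_countable_topology}, 'f::model_space) manifold"
  assumes N: "smooth_manifold N" and Q: "smooth_manifold Q"
  shows "smooth_map (prod_manifold N Q) N fst"
  unfolding smooth_map_on_def
proof (intro conjI ballI)
  show "continuous_on (UNIV :: ('a \<times> 'b) set) fst" by (intro continuous_intros)
  fix C e assume "C \<in> charts (prod_manifold N Q)" and e: "e \<in> charts N"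
  then obtain c d where c: "c \<in> charts N" and d: "d \<in> charts Q" and C: "C = prod_chart c d"
    by (auto simp: charts_prod_manifold)
  have "UNIV \<inter> fst C \<inter> fst -` fst e = (fst c \<inter> fst e) \<times> fst d"
    by (auto simp: C)
  then have im: "snd C ` (UNIV \<inter> fst C \<inter> fst -` fst e) = (snd c ` (fst c \<inter> fst e)) \<times> (snd d ` fst d)"
    by (simp add: C image_prod_chart)
  have U: "open ((snd c ` (fst c \<inter> fst e)) \<times> (snd d ` fst d))"
    by (intro open_Times open_chart_image_Int[OF N c] open_chart_domain[OF N e] open_chart_image[OF Q d])
  have "smooth_on (snd c ` (fst c \<inter> fst e)) (\<lambda>x. snd e (chart_inv c x))"
    using N c e by (auto simp: smooth_manifold_def o_def)
  then have "smooth_on ((snd c ` (fst c \<inter> fst e)) \<times> (snd d ` fst d)) (\<lambda>z. snd e (chart_inv c (fst z)))"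
    by (intro smooth_on_compose[OF U _ smooth_on_bounded_linear[OF U bounded_linear_fst smooth_on_id[OF U]]]) auto
  then show "smooth_on (snd C ` (UNIV \<inter> fst C \<inter> fst -` fst e)) (snd e \<circ> fst \<circ> chart_inv C)"
    unfolding im
    by (subst smooth_on_cong[OF U, of _ "\<lambda>z. snd e (chart_inv c (fst z))"])
      (auto simp: C chart_inv_prod_chart[OF N Q c d] chart_inv_chart[OF N c])
qed

lemma smooth_map_snd:
  fixes N :: "('a::{t2_space, second_countable_topology}, 'e::model_space) manifold"
    and Q :: "('b::{t2_space, second_countable_topology}, 'f::model_space) manifold"
  assumes N: "smooth_manifold N" and Q: "smooth_manifold Q"
  shows "smooth_map (prod_manifold N Q) Q snd"
  unfolding smooth_map_on_def
proof (intro conjI ballI)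
  show "continuous_on (UNIV :: ('a \<times> 'b) set) snd" by (intro continuous_intros)
  fix C e assume "C \<in> charts (prod_manifold N Q)" and e: "e \<in> charts Q"
  then obtain c d where c: "c \<in> charts N" and d: "d \<in> charts Q" and C: "C = prod_chart c d"
    by (auto simp: charts_prod_manifold)
  have "UNIV \<inter> fst C \<inter> snd -` fst e = fst c \<times> (fst d \<inter> fst e)"
    by (auto simp: C)
  then have im: "snd C ` (UNIV \<inter> fst C \<inter> snd -` fst e) = (snd c ` fst c) \<times> (snd d ` (fst d \<inter> fst e))"
    by (simp add: C image_prod_chart)
  have U: "open ((snd c ` fst c) \<times> (snd d ` (fst d \<inter> fst e)))"
    by (intro open_Times open_chart_image_Int[OF Q d] open_chart_domain[OF Q e] open_chart_image[OF N c])
  have "smooth_on (snd d ` (fst d \<inter> fst e)) (\<lambda>x. snd e (chart_inv d x))"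
    using Q d e by (auto simp: smooth_manifold_def o_def)
  then have "smooth_on ((snd c ` fst c) \<times> (snd d ` (fst d \<inter> fst e))) (\<lambda>z. snd e (chart_inv d (snd z)))"
    by (intro smooth_on_compose[OF U _ smooth_on_bounded_linear[OF U bounded_linear_snd smooth_on_id[OF U]]]) auto
  then show "smooth_on (snd C ` (UNIV \<inter> fst C \<inter> snd -` fst e)) (snd e \<circ> snd \<circ> chart_inv C)"
    unfolding im
    by (subst smooth_on_cong[OF U, of _ "\<lambda>z. snd e (chart_inv d (snd z))"])
      (auto simp: C chart_inv_prod_chart[OF N Q c d] chart_inv_chart[OF Q d])
qed

lemma smooth_map_on_Pair:
  fixes f :: "'a::{t2_space, second_countable_topology} \<Rightarrow> 'b::{t2_space, second_countable_topology}"
    and g :: "'a \<Rightarrow> 'c::{t2_space, second_countable_topology}"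
  assumes M: "smooth_manifold N" "smooth_manifold Q" "smooth_manifold R" and W: "open W"
    and f: "smooth_map_on N Q W f" and g: "smooth_map_on N R W g"
  shows "smooth_map_on N (prod_manifold Q R) W (\<lambda>x. (f x, g x))"
  unfolding smooth_map_on_def
proof (intro conjI ballI)
  show cont: "continuous_on W (\<lambda>x. (f x, g x))"
    using f g by (auto simp: smooth_map_on_def intro: continuous_on_Pair)
  fix c D assume c: "c \<in> charts N" and "D \<in> charts (prod_manifold Q R)"
  then obtain d e where d: "d \<in> charts Q" and e: "e \<in> charts R" and D: "D = prod_chart d e"
    by (auto simp: charts_prod_manifold)
  let ?U = "snd c ` (W \<inter> fst c \<inter> (\<lambda>x. (f x, g x)) -` fst D)"
  have U: "open ?U"
    by (rule open_image_preimage[OF M(1) c W cont])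
      (simp add: D open_Times open_chart_domain[OF M(2) d] open_chart_domain[OF M(3) e])
  have "smooth_on ?U (\<lambda>x. (snd d (f (chart_inv c x)), snd e (g (chart_inv c x))))"
    by (intro smooth_on_Pair[OF U] smooth_on_subset[OF smooth_map_on_chart(2)[OF M(1,2) W f c d]]
        smooth_on_subset[OF smooth_map_on_chart(2)[OF M(1,3) W g c e]]) (auto simp: D)
  then show "smooth_on ?U (snd D \<circ> (\<lambda>x. (f x, g x)) \<circ> chart_inv c)"
    by (simp add: D o_def)
qed

text \<open>A local extension of f, precomposed with h, extends the composite on the preimage of its
  neighbourhood.\<close>

lemma smooth_map_within_compose:
  fixes h :: "'a::{t2_space, second_countable_topology} \<Rightarrow> 'b::{t2_space, second_countable_topology}"
    and f :: "'b \<Rightarrow> 'c::{t2_space, second_countable_topology}"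
  assumes M: "smooth_manifold N" "smooth_manifold Q" "smooth_manifold R"
    and h: "smooth_map N Q h" "\<And>x. x \<in> S \<Longrightarrow> h x \<in> T"
    and f: "smooth_map_within Q R T f"
  shows "smooth_map_within N R S (\<lambda>x. f (h x))"
  unfolding smooth_map_within_def
proof
  fix p assume "p \<in> S"
  then obtain F W where W: "open W" "h p \<in> W" "smooth_map_on Q R W F" "\<forall>x\<in>W \<inter> T. F x = f x"
    using f h(2) unfolding smooth_map_within_def local_extension_def by meson
  have cont: "continuous_on UNIV h" using h(1) by (simp add: smooth_map_on_def)
  have V: "open (h -` W)" using open_vimage[OF W(1) cont] .
  have "smooth_map_on N Q (h -` W) h"
  proof -
    have "smooth_on (snd c ` (h -` W \<inter> fst c \<inter> h -` fst d)) (snd d \<circ> h \<circ> chart_inv c)"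
      if "c \<in> charts N" "d \<in> charts Q" for c d
      by (rule smooth_on_subset[of "snd c ` (UNIV \<inter> fst c \<inter> h -` fst d)"])
        (use h(1) that in \<open>auto simp: smooth_map_on_def\<close>)
    then show ?thesis
      using continuous_on_subset[OF cont] by (auto simp: smooth_map_on_def)
  qed
  then have "smooth_map_on N R (h -` W) (\<lambda>x. F (h x))"
    by (intro smooth_map_on_compose[OF M V W(1) _ _ W(3)]) auto
  then show "\<exists>F. local_extension N R S (\<lambda>x. f (h x)) p F"
    unfolding local_extension_def using V W(2,4) h(2)
    by (intro exI[of _ "\<lambda>x. F (h x)"] exI[of _ "h -` W"]) auto
qed

section \<open>Velocities of curves\<close>

lemma tangent_map_has_derivative:
  assumes M: "smooth_manifold N" "smooth_manifold Q" and W: "open W" "p \<in> W" and f: "smooth_map_on N Q W f"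
  shows "((\<lambda>x. snd (chart_at Q (f p)) (f (chart_inv (chart_at N p) x))) has_derivative tangent_map N Q f p)
    (at (snd (chart_at N p) p))"
proof -
  note cd = smooth_manifold_chart_at[OF M(1)] smooth_manifold_chart_at[OF M(2)]
  show ?thesis
    using smooth_on_derivative[OF smooth_map_on_chart(2)[OF M W(1) f cd(1) cd(3)[of "f p"]], of "snd (chart_at N p) p"]
      W(2) cd(2,4) by (auto simp: tangent_map_def o_def)
qed

lemma linear_tangent_map:
  assumes "smooth_manifold N" "smooth_manifold Q" "open W" "p \<in> W" "smooth_map_on N Q W f"
  shows "linear (tangent_map N Q f p)"
  using tangent_map_has_derivative[OF assms] has_derivative_linear by blast

text \<open>\<open>curve_at N \<gamma> p v\<close>: the curve \<open>\<gamma>\<close>, defined for all times but regular only at time 0, has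
  velocity \<open>v\<close> at \<open>\<gamma> 0 = p\<close>.\<close>

definition curve_at ::
  "('a::topological_space, 'e::model_space) manifold \<Rightarrow> (real \<Rightarrow> 'a) \<Rightarrow> 'a \<Rightarrow> 'e \<Rightarrow> bool" where
  "curve_at N \<gamma> p v \<longleftrightarrow> \<gamma> 0 = p \<and> isCont \<gamma> 0 \<and>
     ((\<lambda>t. snd (chart_at N p) (\<gamma> t)) has_vector_derivative v) (at 0)"

text \<open>The curve stays in S at all times, not only near 0, so conditional laws such as
  associativity of composable arrows hold along the whole curve.\<close>

definition tangent_to ::
  "('a::topological_space, 'e::model_space) manifold \<Rightarrow> 'a set \<Rightarrow> 'a \<Rightarrow> 'e \<Rightarrow> bool" where
  "tangent_to N S p v \<longleftrightarrow> (\<exists>\<gamma>. curve_at N \<gamma> p v \<and> (\<forall>t. \<gamma> t \<in> S))"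

lemma has_vector_derivative_transform_eventually:
  assumes "(f has_vector_derivative v) (at t)" "\<forall>\<^sub>F s in at t. f s = g s" "f t = g t"
  shows "(g has_vector_derivative v) (at t)"
  using assms unfolding has_vector_derivative_def
  by (auto intro: has_derivative_transform_eventually)

lemma curve_at_unique: "curve_at N \<gamma> p v \<Longrightarrow> curve_at N \<gamma> p w \<Longrightarrow> v = w"
  unfolding curve_at_def using vector_derivative_unique_at by blast

lemma curve_at_0: "curve_at N \<gamma> p v \<Longrightarrow> \<gamma> 0 = p"
  by (simp add: curve_at_def)

lemma curve_at_const: "curve_at N (\<lambda>t. p) p 0"
  by (simp add: curve_at_def)

lemma isCont_eventually_in:
  assumes "isCont \<gamma> (x::real)" "open W" "\<gamma> x \<in> W"
  shows "\<forall>\<^sub>F t in at x. \<gamma> t \<in> W"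
  using topological_tendstoD[OF assms(1)[unfolded isCont_def] assms(2,3)] .

lemma curve_at_cong:
  assumes \<gamma>: "curve_at N \<gamma> p v" and eq: "\<forall>\<^sub>F t in at 0. \<gamma> t = \<eta> t" "\<gamma> 0 = \<eta> 0"
  shows "curve_at N \<eta> p v"
proof -
  have "(\<gamma> \<longlongrightarrow> \<eta> 0) (at 0)"
    using \<gamma> eq(2) by (auto simp: curve_at_def isCont_def)
  then have "isCont \<eta> 0"
    unfolding isCont_def by (rule Lim_transform_eventually[OF _ eq(1)])
  moreover have "((\<lambda>t. snd (chart_at N p) (\<eta> t)) has_vector_derivative v) (at 0)"
    by (rule has_vector_derivative_transform_eventually[of "\<lambda>t. snd (chart_at N p) (\<gamma> t)"])
      (use \<gamma> eq in \<open>auto simp: curve_at_def elim: eventually_mono\<close>)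
  ultimately show ?thesis
    using \<gamma> eq(2) by (simp add: curve_at_def)
qed

lemma curve_at_Pair:
  assumes "curve_at N \<gamma> p v" "curve_at Q \<eta> q w"
  shows "curve_at (prod_manifold N Q) (\<lambda>t. (\<gamma> t, \<eta> t)) (p, q) (v, w)"
  using assms unfolding curve_at_def chart_at_prod_manifold prod_chart_simps
  by (auto intro: isCont_Pair has_vector_derivative_Pair)

lemma curve_at_fst:
  assumes "curve_at (prod_manifold N Q) \<gamma> (p, q) (v, w)"
  shows "curve_at N (\<lambda>t. fst (\<gamma> t)) p v"
proof -
  have "((\<lambda>t. snd (prod_chart (chart_at N p) (chart_at Q q)) (\<gamma> t)) has_vector_derivative (v, w)) (at 0)"
    using assms by (simp add: curve_at_def chart_at_prod_manifold)
  from bounded_linear.has_vector_derivative[OF bounded_linear_fst this] show ?thesis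
    using assms by (simp add: curve_at_def prod_chart_def)
qed

lemma curve_at_snd:
  assumes "curve_at (prod_manifold N Q) \<gamma> (p, q) (v, w)"
  shows "curve_at Q (\<lambda>t. snd (\<gamma> t)) q w"
proof -
  have "((\<lambda>t. snd (prod_chart (chart_at N p) (chart_at Q q)) (\<gamma> t)) has_vector_derivative (v, w)) (at 0)"
    using assms by (simp add: curve_at_def chart_at_prod_manifold)
  from bounded_linear.has_vector_derivative[OF bounded_linear_snd this] show ?thesis
    using assms by (simp add: curve_at_def prod_chart_def)
qed

text \<open>This is the chain rule in the preferred charts at p and f p. The coordinate expression
  represents \<open>f (\<gamma> t)\<close> only while \<gamma> stays in the chart domain, so the two
  curves are compared near time 0.\<close>

lemma curve_at_image:
  assumes M: "smooth_manifold N" "smooth_manifold Q" and W: "open W" "p \<in> W" and f: "smooth_map_on N Q W f"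
    and \<gamma>: "curve_at N \<gamma> p v"
  shows "curve_at Q (\<lambda>t. f (\<gamma> t)) (f p) (tangent_map N Q f p v)"
proof -
  let ?c = "chart_at N p" and ?d = "chart_at Q (f p)"
  note c = smooth_manifold_chart_at[OF M(1), of p]
  have \<gamma>0: "\<gamma> 0 = p" and cont: "isCont \<gamma> 0"
    and der: "((\<lambda>t. snd ?c (\<gamma> t)) has_vector_derivative v) (at 0)"
    using \<gamma> by (auto simp: curve_at_def)
  have "isCont f (\<gamma> 0)"
    using f W \<gamma>0 by (simp add: smooth_map_on_def continuous_on_eq_continuous_at)
  then have "isCont (\<lambda>t. f (\<gamma> t)) 0"
    using isCont_o2[OF cont] by blast
  moreover have "((\<lambda>t. snd ?d (f (\<gamma> t))) has_vector_derivative tangent_map N Q f p v) (at 0)"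
  proof -
    have "((\<lambda>x. snd ?d (f (chart_inv ?c x))) has_derivative tangent_map N Q f p) (at (snd ?c (\<gamma> 0)))"
      using tangent_map_has_derivative[OF M W f] \<gamma>0 by simp
    from diff_chain_at[OF der[unfolded has_vector_derivative_def] this]
    have "((\<lambda>t. snd ?d (f (chart_inv ?c (snd ?c (\<gamma> t))))) has_derivative (\<lambda>t. tangent_map N Q f p (t *\<^sub>R v))) (at 0)"
      by (simp add: o_def)
    then have "((\<lambda>t. snd ?d (f (chart_inv ?c (snd ?c (\<gamma> t))))) has_vector_derivative tangent_map N Q f p v) (at 0)"
      by (simp add: has_vector_derivative_def linear_scale[OF linear_tangent_map[OF M W f]])
    moreover have "\<forall>\<^sub>F t in at 0. \<gamma> t \<in> fst ?c"
      using isCont_eventually_in[OF cont open_chart_domain[OF M(1) c(1)]] c(2) \<gamma>0 by simp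
    then have "\<forall>\<^sub>F t in at 0. snd ?d (f (chart_inv ?c (snd ?c (\<gamma> t)))) = snd ?d (f (\<gamma> t))"
      by (rule eventually_mono) (simp add: chart_inv_chart[OF M(1) c(1)])
    ultimately show ?thesis
      by (rule has_vector_derivative_transform_eventually) (simp add: chart_inv_chart[OF M(1) c(1)] c(2) \<gamma>0)
  qed
  ultimately show ?thesis
    by (simp add: curve_at_def \<gamma>0)
qed

lemma tangent_toI_coordinates:
  assumes N: "smooth_manifold N" and p: "p \<in> S"
    and y: "y 0 = snd (chart_at N p) p" "(y has_vector_derivative v) (at 0)"
    and S: "\<forall>\<^sub>F t in at 0. chart_inv (chart_at N p) (y t) \<in> S"
  shows "tangent_to N S p v"
proof -
  let ?c = "chart_at N p"
  note c = smooth_manifold_chart_at[OF N, of p]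
  let ?U = "snd ?c ` fst ?c"
  have inv: "chart_inv ?c (y 0) = p"
    by (simp add: y(1) chart_inv_chart[OF N c(1)] c(2))
  have U: "y 0 \<in> ?U" "open ?U"
    using y(1) c(2) open_chart_image[OF N c(1)] by auto
  have cy: "isCont y 0"
    using y(2) has_vector_derivative_continuous by blast
  \<comment> \<open>Resetting the curve to p at bad times keeps it in S forever; its germ at 0, and
    thus its velocity, is unaffected.\<close>
  define \<gamma> where "\<gamma> t = (if y t \<in> ?U \<and> chart_inv ?c (y t) \<in> S then chart_inv ?c (y t) else p)" for t
  have ev: "\<forall>\<^sub>F t in at 0. y t \<in> ?U \<and> chart_inv ?c (y t) \<in> S"
    using isCont_eventually_in[OF cy U(2,1)] S by (rule eventually_conj)
  then have ev1: "\<forall>\<^sub>F t in at 0. chart_inv ?c (y t) = \<gamma> t"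
    by (rule eventually_mono) (simp add: \<gamma>_def)
  have \<gamma>0: "\<gamma> 0 = p" by (simp add: \<gamma>_def inv)
  have "isCont (chart_inv ?c) (y 0)"
    using continuous_on_chart_inv[OF N c(1)] U continuous_on_eq_continuous_at by blast
  then have "isCont (\<lambda>t. chart_inv ?c (y t)) 0"
    using isCont_o2[OF cy] by blast
  then have "((\<lambda>t. chart_inv ?c (y t)) \<longlongrightarrow> \<gamma> 0) (at 0)"
    by (simp add: isCont_def inv \<gamma>0)
  then have "isCont \<gamma> 0"
    unfolding isCont_def by (rule Lim_transform_eventually[OF _ ev1])
  moreover have "((\<lambda>t. snd ?c (\<gamma> t)) has_vector_derivative v) (at 0)"
  proof (rule has_vector_derivative_transform_eventually[OF y(2)])
    show "\<forall>\<^sub>F t in at 0. y t = snd ?c (\<gamma> t)"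
      using ev by (rule eventually_mono) (auto simp: \<gamma>_def chart_inv_chart[OF N c(1)])
  qed (simp add: \<gamma>0 y(1))
  moreover have "\<gamma> t \<in> S" for t
    by (simp add: \<gamma>_def p)
  ultimately show ?thesis
    unfolding tangent_to_def curve_at_def using \<gamma>0 by blast
qed

lemma tangent_to_UNIV:
  assumes "smooth_manifold N"
  shows "tangent_to N UNIV p v"
proof (rule tangent_toI_coordinates[OF assms, where y = "\<lambda>t. snd (chart_at N p) p + t *\<^sub>R v"])
  show "((\<lambda>t. snd (chart_at N p) p + t *\<^sub>R v) has_vector_derivative v) (at 0)"
    by (auto intro!: derivative_eq_intros)
qed auto

text \<open>The surjectivity assumption is a transversality condition: in a chart around f p = g p
  the difference of the two maps is a submersion at p, so \<open>implicit_curve\<close> yields a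
  curve in its zero set.\<close>

lemma tangent_to_equalizer:
  fixes f g :: "'a::{t2_space, second_countable_topology} \<Rightarrow> 'b::{t2_space, second_countable_topology}"
  assumes M: "smooth_manifold N" "smooth_manifold Q" and f: "smooth_map N Q f" and g: "smooth_map N Q g"
    and p: "f p = g p" and surj: "surj (\<lambda>v. tangent_map N Q f p v - tangent_map N Q g p v)"
    and v: "tangent_map N Q f p v = tangent_map N Q g p v"
  shows "tangent_to N {x. f x = g x} p v"
proof -
  let ?c = "chart_at N p" and ?d = "chart_at Q (f p)"
  note c = smooth_manifold_chart_at[OF M(1), of p]
  note d = smooth_manifold_chart_at[OF M(2), of "f p"]
  let ?F = "\<lambda>x. snd ?d (f (chart_inv ?c x))" and ?G = "\<lambda>x. snd ?d (g (chart_inv ?c x))"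
  let ?U = "snd ?c ` (UNIV \<inter> fst ?c \<inter> (\<lambda>x. (f x, g x)) -` (fst ?d \<times> fst ?d))"
  have U: "open ?U"
    using f g open_chart_domain[OF M(2) d(1)]
    by (intro open_image_preimage[OF M(1) c(1)]) (auto simp: smooth_map_on_def intro: continuous_on_Pair open_Times)
  have x: "snd ?c p \<in> ?U"
    using c(2) d(2) p by auto
  have smooth: "smooth_on ?U (\<lambda>x. ?F x - ?G x)"
    by (intro smooth_on_diff[OF U] smooth_on_subset[OF smooth_map_on_chart(2)[OF M open_UNIV f c(1) d(1)]]
        smooth_on_subset[OF smooth_map_on_chart(2)[OF M open_UNIV g c(1) d(1)]]) auto
  have "((\<lambda>x. ?F x - ?G x) has_derivative (\<lambda>v. tangent_map N Q f p v - tangent_map N Q g p v)) (at (snd ?c p))"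
    using has_derivative_diff[OF tangent_map_has_derivative[OF M open_UNIV UNIV_I f]
        tangent_map_has_derivative[OF M open_UNIV UNIV_I g], of p] p by simp
  then have D: "frechet_derivative (\<lambda>x. ?F x - ?G x) (at (snd ?c p)) = (\<lambda>v. tangent_map N Q f p v - tangent_map N Q g p v)"
    by (rule frechet_derivative_at[symmetric])
  obtain y where y: "y 0 = snd ?c p" "(y has_vector_derivative v) (at 0)" "\<forall>\<^sub>F t in at 0. ?F (y t) - ?G (y t) = 0"
  proof (rule implicit_curve[OF smooth U x, unfolded D])
    show "?F (snd ?c p) - ?G (snd ?c p) = 0"
      by (simp add: chart_inv_chart[OF M(1) c(1)] c(2) p)
    show "surj (\<lambda>v. tangent_map N Q f p v - tangent_map N Q g p v)" by (rule surj)
    show "tangent_map N Q f p v - tangent_map N Q g p v = 0" by (simp add: v)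
  qed (rule that)
  show ?thesis
  proof (rule tangent_toI_coordinates[OF M(1) _ y(1,2)])
    have "isCont y 0"
      using y(2) has_vector_derivative_continuous by blast
    \<comment> \<open>Equal coordinates mean equal points only inside the chart domain, so both
      images have to be kept there.\<close>
    then have "\<forall>\<^sub>F t in at 0. y t \<in> ?U"
      using isCont_eventually_in[OF _ U] x y(1) by simp
    then show "\<forall>\<^sub>F t in at 0. chart_inv ?c (y t) \<in> {x. f x = g x}"
      using y(3)
    proof eventually_elim
      case (elim t)
      have "f (chart_inv ?c (y t)) \<in> fst ?d" "g (chart_inv ?c (y t)) \<in> fst ?d"
        using elim(1) by (auto simp: chart_inv_chart[OF M(1) c(1)])
      then show ?case
        using elim(2) inj_on_chart[OF M(2) d(1)] by (auto dest: inj_onD)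
    qed
  qed (simp add: p)
qed

section \<open>Differentials along subsets\<close>

text \<open>Near time 0 the curves \<open>F (\<gamma> t)\<close> and \<open>f (\<gamma> t)\<close>
  coincide. The latter does not involve F, so uniqueness of velocities makes the differential
  independent of the extension.\<close>

lemma curve_at_local_extension:
  assumes M: "smooth_manifold N" "smooth_manifold Q" and p: "p \<in> S" and F: "local_extension N Q S f p F"
    and \<gamma>: "curve_at N \<gamma> p v" "\<And>t. \<gamma> t \<in> S"
  shows "curve_at Q (\<lambda>t. f (\<gamma> t)) (f p) (tangent_map N Q F p v)"
proof -
  obtain W where W: "open W" "p \<in> W" "smooth_map_on N Q W F" "\<forall>x\<in>W \<inter> S. F x = f x"
    using F by (auto simp: local_extension_def)
  have "F p = f p" using W p by auto
  then have "curve_at Q (\<lambda>t. F (\<gamma> t)) (f p) (tangent_map N Q F p v)"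
    using curve_at_image[OF M W(1-3) \<gamma>(1)] by simp
  moreover have "\<forall>\<^sub>F t in at 0. \<gamma> t \<in> W"
    using isCont_eventually_in[OF _ W(1)] \<gamma>(1) W(2) by (auto simp: curve_at_def)
  then have "\<forall>\<^sub>F t in at 0. F (\<gamma> t) = f (\<gamma> t)"
    by (rule eventually_mono) (use W(4) \<gamma>(2) in auto)
  ultimately show ?thesis
    by (rule curve_at_cong) (use \<open>F p = f p\<close> curve_at_0[OF \<gamma>(1)] in simp)
qed

lemma tangent_map_within_eq:
  assumes M: "smooth_manifold N" "smooth_manifold Q" and p: "p \<in> S" and F: "local_extension N Q S f p F"
    and v: "tangent_to N S p v"
  shows "tangent_map_within N Q S f p v = tangent_map N Q F p v"
  unfolding tangent_map_within_def
proof (rule the_equality)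
  show "\<exists>F'. local_extension N Q S f p F' \<and> tangent_map N Q F p v = tangent_map N Q F' p v"
    using F by blast
  fix w assume "\<exists>F'. local_extension N Q S f p F' \<and> w = tangent_map N Q F' p v"
  then show "w = tangent_map N Q F p v"
    using v curve_at_local_extension[OF M p] F curve_at_unique unfolding tangent_to_def by metis
qed

lemma curve_at_within:
  assumes M: "smooth_manifold N" "smooth_manifold Q" and p: "p \<in> S" and f: "smooth_map_within N Q S f"
    and \<gamma>: "curve_at N \<gamma> p v" "\<And>t. \<gamma> t \<in> S"
  shows "curve_at Q (\<lambda>t. f (\<gamma> t)) (f p) (tangent_map_within N Q S f p v)"
proof -
  obtain F where F: "local_extension N Q S f p F"
    using f p by (auto simp: smooth_map_within_def)
  have "tangent_to N S p v"
    using \<gamma> by (auto simp: tangent_to_def)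
  then show ?thesis
    using curve_at_local_extension[OF M p F \<gamma>] tangent_map_within_eq[OF M p F] by simp
qed

text \<open>L is the differential of one fixed extension. It is linear on the whole tangent space of
  N, whereas \<open>tangent_map_within\<close> is controlled only at tangent vectors of S; hence the
  detour through L.\<close>

lemma tangent_map_within_linear:
  assumes M: "smooth_manifold N" "smooth_manifold Q" and p: "p \<in> S" and f: "smooth_map_within N Q S f"
  obtains L where "linear L" "\<And>v. tangent_to N S p v \<Longrightarrow> tangent_map_within N Q S f p v = L v"
proof -
  obtain F W where F: "local_extension N Q S f p F" and W: "open W" "p \<in> W" "smooth_map_on N Q W F"
  proof -
    obtain F where F: "local_extension N Q S f p F"
      using f p by (auto simp: smooth_map_within_def)
    then show ?thesis
      using that by (auto simp: local_extension_def)
  qed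
  show thesis
    using that[OF linear_tangent_map[OF M W]] tangent_map_within_eq[OF M p F] by blast
qed

section \<open>Lie groupoids\<close>

lemma curve_at_smooth_map:
  "smooth_manifold N \<Longrightarrow> smooth_manifold Q \<Longrightarrow> smooth_map N Q f \<Longrightarrow> curve_at N \<gamma> p v \<Longrightarrow>
    curve_at Q (\<lambda>t. f (\<gamma> t)) (f p) (tangent_map N Q f p v)"
  using curve_at_image[OF _ _ open_UNIV UNIV_I] .

text \<open>The standard way below to compute a differential: recognize the image curve. The
  separate base point q allows that curve to be given in simplified form.\<close>

lemma tangent_map_curve:
  assumes "smooth_manifold N" "smooth_manifold Q" "smooth_map N Q f" "curve_at N \<gamma> p v"
    and "curve_at Q (\<lambda>t. f (\<gamma> t)) q w" "q = f p"
  shows "tangent_map N Q f p v = w"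
  using curve_at_unique[OF curve_at_smooth_map[OF assms(1-4)]] assms(5,6) by simp

lemma obtain_curve:
  assumes "smooth_manifold N"
  obtains \<gamma> where "curve_at N \<gamma> p v"
  using tangent_to_UNIV[OF assms] by (auto simp: tangent_to_def)

lemma tangent_map_const:
  assumes "smooth_manifold N" "smooth_manifold Q"
  shows "tangent_map N Q (\<lambda>x. q) p v = 0"
proof -
  obtain \<gamma> where "curve_at N \<gamma> p v" using obtain_curve[OF assms(1)] .
  from tangent_map_curve[OF assms smooth_map_const[OF assms(1)] this curve_at_const] show ?thesis by simp
qed

lemma linear_smooth_map:
  "smooth_manifold N \<Longrightarrow> smooth_manifold Q \<Longrightarrow> smooth_map N Q f \<Longrightarrow> linear (tangent_map N Q f p)"
  using linear_tangent_map[OF _ _ open_UNIV UNIV_I] .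

section \<open>Tangent vectors of fibres and fibre products\<close>

lemma tangent_to_fibre:
  fixes f :: "'a::{t2_space, second_countable_topology} \<Rightarrow> 'b::{t2_space, second_countable_topology}"
  assumes M: "smooth_manifold N" "smooth_manifold Q" and f: "submersion N Q f" and v: "tangent_map N Q f p v = 0"
  shows "tangent_to N {x. f x = f p} p v"
proof (rule tangent_to_equalizer[OF M _ smooth_map_const[OF M(1)]])
  show "smooth_map N Q f" "surj (\<lambda>v. tangent_map N Q f p v - tangent_map N Q (\<lambda>x. f p) p v)"
    using f by (simp_all add: submersion_def tangent_map_const[OF M])
qed (simp_all add: tangent_map_const[OF M] v)

lemma tangent_to_fibre_product:
  fixes f :: "'a::{t2_space, second_countable_topology} \<Rightarrow> 'c::{t2_space, second_countable_topology}"
    and g :: "'b::{t2_space, second_countable_topology} \<Rightarrow> 'c"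
  assumes M: "smooth_manifold N" "smooth_manifold Q" "smooth_manifold R"
    and f: "smooth_map N R f" and g: "submersion Q R g" and pq: "f p = g q"
    and vw: "tangent_map N R f p v = tangent_map Q R g q w"
  shows "tangent_to (prod_manifold N Q) {(x, y). f x = g y} (p, q) (v, w)"
proof -
  let ?P = "prod_manifold N Q"
  note P = smooth_manifold_prod[OF M(1,2)]
  have g': "smooth_map Q R g" using g by (simp add: submersion_def)
  note fst = smooth_map_on_compose[OF P M(1) M(3) open_UNIV open_UNIV subset_UNIV smooth_map_fst[OF M(1,2)] f]
  note snd = smooth_map_on_compose[OF P M(2) M(3) open_UNIV open_UNIV subset_UNIV smooth_map_snd[OF M(1,2)] g']
  have df: "tangent_map ?P R (\<lambda>x. f (fst x)) (p, q) (v, w) = tangent_map N R f p v"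
    and dg: "tangent_map ?P R (\<lambda>x. g (snd x)) (p, q) (v, w) = tangent_map Q R g q w" for v w
  proof -
    obtain \<gamma> where \<gamma>: "curve_at ?P \<gamma> (p, q) (v, w)" using obtain_curve[OF P] .
    show "tangent_map ?P R (\<lambda>x. f (fst x)) (p, q) (v, w) = tangent_map N R f p v"
      by (rule tangent_map_curve[OF P M(3) fst \<gamma> curve_at_smooth_map[OF M(1,3) f curve_at_fst[OF \<gamma>]]]) simp
    show "tangent_map ?P R (\<lambda>x. g (snd x)) (p, q) (v, w) = tangent_map Q R g q w"
      by (rule tangent_map_curve[OF P M(3) snd \<gamma> curve_at_smooth_map[OF M(2,3) g' curve_at_snd[OF \<gamma>]]]) simp
  qed
  have "surj (\<lambda>v. tangent_map ?P R (\<lambda>x. f (fst x)) (p, q) v - tangent_map ?P R (\<lambda>x. g (snd x)) (p, q) v)"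
  proof (rule surjI)
    fix y
    have surj: "surj (tangent_map Q R g q)" using g by (simp add: submersion_def)
    \<comment> \<open>Moving the second factor alone reaches every vector because g is a submersion;
      the sign compensates the subtraction.\<close>
    show "tangent_map ?P R (\<lambda>x. f (fst x)) (p, q) (0, inv (tangent_map Q R g q) (- y)) -
        tangent_map ?P R (\<lambda>x. g (snd x)) (p, q) (0, inv (tangent_map Q R g q) (- y)) = y"
      by (simp add: df dg linear_0[OF linear_smooth_map[OF M(1,3) f]] surj_f_inv_f[OF surj])
  qed
  then have "tangent_to ?P {x. f (fst x) = g (snd x)} (p, q) (v, w)"
    by (intro tangent_to_equalizer[OF P M(3) fst snd]) (simp_all add: df dg pq vw)
  then show ?thesis by (simp add: case_prod_unfold)
qed

locale lie_gpd =
  fixes X :: "('o::{t2_space, second_countable_topology}, 'eo::model_space,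
               'g::{t2_space, second_countable_topology}, 'eg::model_space) groupoid"
  assumes lie: "lie_groupoid X"
begin

abbreviation "ds \<equiv> tangent_map (arrs X) (objs X) (src X)"
abbreviation "dt \<equiv> tangent_map (arrs X) (objs X) (tgt X)"
abbreviation "di \<equiv> tangent_map (arrs X) (arrs X) (invs X)"
abbreviation "composable \<equiv> {(g, h). src X g = tgt X h}"
abbreviation "dmult g h v w \<equiv>
  tangent_map_within (prod_manifold (arrs X) (arrs X)) (arrs X) composable (\<lambda>(g, h). mult X g h) (g, h) (v, w)"

lemma manifolds: "smooth_manifold (objs X)" "smooth_manifold (arrs X)"
  using lie by (simp_all add: lie_groupoid_def)

lemma submersions: "submersion (arrs X) (objs X) (src X)" "submersion (arrs X) (objs X) (tgt X)"
  using lie by (simp_all add: lie_groupoid_def)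

lemma smooth_maps: "smooth_map (arrs X) (objs X) (src X)" "smooth_map (arrs X) (objs X) (tgt X)"
    "smooth_map (arrs X) (arrs X) (invs X)"
  using lie by (simp_all add: lie_groupoid_def submersion_def)

lemma smooth_mult:
  "smooth_map_within (prod_manifold (arrs X) (arrs X)) (arrs X) composable (\<lambda>(g, h). mult X g h)"
  using lie by (simp add: lie_groupoid_def)

lemma ident_simps [simp]: "src X (ident X x) = x" "tgt X (ident X x) = x"
  using lie by (simp_all add: lie_groupoid_def)

lemma mult_simps [simp]:
  "src X g = tgt X h \<Longrightarrow> src X (mult X g h) = src X h"
  "src X g = tgt X h \<Longrightarrow> tgt X (mult X g h) = tgt X g"
  "x = tgt X g \<Longrightarrow> mult X (ident X x) g = g"
  "x = src X g \<Longrightarrow> mult X g (ident X x) = g"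
  using lie by (simp_all add: lie_groupoid_def)

lemma mult_assoc:
  "src X g = tgt X h \<Longrightarrow> src X h = tgt X k \<Longrightarrow> mult X (mult X g h) k = mult X g (mult X h k)"
  using lie by (simp add: lie_groupoid_def)

lemma invs_simps [simp]:
  "src X (invs X g) = tgt X g" "tgt X (invs X g) = src X g"
  "mult X g (invs X g) = ident X (tgt X g)" "mult X (invs X g) g = ident X (src X g)"
  using lie by (simp_all add: lie_groupoid_def)

lemma mult_invs_cancel [simp]:
  "src X g = tgt X h \<Longrightarrow> mult X (invs X g) (mult X g h) = h"
  "tgt X g = tgt X h \<Longrightarrow> mult X g (mult X (invs X g) h) = h"
  by (simp_all add: mult_assoc[symmetric])

lemma invs_unique:
  assumes "src X h = tgt X g" "mult X h g = ident X (src X g)"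
  shows "invs X g = h"
proof -
  have "h = mult X (mult X h g) (invs X g)"
    using assms(1) by (simp add: mult_assoc)
  then show ?thesis by (simp add: assms(2))
qed

lemma invs_ident [simp]: "invs X (ident X x) = ident X x"
  by (rule invs_unique) simp_all

lemma invs_invs [simp]: "invs X (invs X g) = g"
  by (rule invs_unique) simp_all

lemma invs_mult: "src X g = tgt X h \<Longrightarrow> invs X (mult X g h) = mult X (invs X h) (invs X g)"
  by (rule invs_unique) (simp_all add: mult_assoc)

lemma linear_ds: "linear (ds g)" and linear_dt: "linear (dt g)" and linear_di: "linear (di g)"
  using linear_smooth_map manifolds smooth_maps by blast+

lemma obtain_src_fibre_curve:
  assumes "v \<in> ker_ds X g"
  obtains \<gamma> where "curve_at (arrs X) \<gamma> g v" "\<And>t. src X (\<gamma> t) = src X g"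
proof -
  have "tangent_to (arrs X) {h. src X h = src X g} g v"
    by (rule tangent_to_fibre[OF manifolds(2,1) submersions(1)]) (use assms in \<open>simp add: ker_ds_def\<close>)
  then show thesis
    using that by (auto simp: tangent_to_def)
qed

lemma curve_at_ker_ds:
  assumes "curve_at (arrs X) \<gamma> g v" "\<And>t. src X (\<gamma> t) = src X g"
  shows "v \<in> ker_ds X g"
  using tangent_map_curve[OF manifolds(2,1) smooth_maps(1) assms(1)] curve_at_const[of "objs X" "src X g"]
  by (simp add: ker_ds_def assms(2))

lemma subspace_ker_ds: "subspace (ker_ds X g)"
  unfolding ker_ds_def by (rule linear_subspace_kernel[OF linear_ds])

section \<open>Differentials of multiplication and translations\<close>

lemma curve_at_mult:
  assumes "curve_at (arrs X) \<gamma> g v" "curve_at (arrs X) \<eta> h w" "\<And>t. src X (\<gamma> t) = tgt X (\<eta> t)"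
  shows "curve_at (arrs X) (\<lambda>t. mult X (\<gamma> t) (\<eta> t)) (mult X g h) (dmult g h v w)"
proof -
  have "(g, h) \<in> composable"
    using assms(3)[of 0] curve_at_0[OF assms(1)] curve_at_0[OF assms(2)] by simp
  from curve_at_within[OF smooth_manifold_prod[OF manifolds(2,2)] manifolds(2) this smooth_mult
      curve_at_Pair[OF assms(1,2)]]
  show ?thesis by (simp add: assms(3))
qed

text \<open>The two kernel conditions make (v, 0) and (0, w) tangent to the composable pairs
  separately, so each summand is meaningful and the linear L of
  \<open>tangent_map_within_linear\<close> applies.\<close>

lemma dmult_split:
  assumes "src X g = tgt X h" "v \<in> ker_ds X g" "dt h w = 0"
  shows "dmult g h v w = dmult g h v 0 + dmult g h 0 w"
proof -
  have gh: "(g, h) \<in> composable" using assms(1) by simp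
  have T: "tangent_to (prod_manifold (arrs X) (arrs X)) composable (g, h) (v', w')" if "ds g v' = dt h w'" for v' w'
    by (rule tangent_to_fibre_product[OF manifolds(2,2,1) smooth_maps(1) submersions(2) assms(1) that])
  have tan: "tangent_to (prod_manifold (arrs X) (arrs X)) composable (g, h) (v, w)"
    "tangent_to (prod_manifold (arrs X) (arrs X)) composable (g, h) (v, 0)"
    "tangent_to (prod_manifold (arrs X) (arrs X)) composable (g, h) (0, w)"
    using assms(2,3) by (auto intro!: T simp: ker_ds_def linear_0[OF linear_ds] linear_0[OF linear_dt])
  obtain L where "linear L" "\<And>v. tangent_to (prod_manifold (arrs X) (arrs X)) composable (g, h) v \<Longrightarrow>
      tangent_map_within (prod_manifold (arrs X) (arrs X)) (arrs X) composable (\<lambda>(g, h). mult X g h) (g, h) v = L v"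
    using tangent_map_within_linear[OF smooth_manifold_prod[OF manifolds(2,2)] manifolds(2) gh smooth_mult] by blast
  then show ?thesis
    using tan linear_add[of L "(v, 0)" "(0, w)"] by simp
qed

lemma smooth_right_mult:
  "smooth_map_within (arrs X) (arrs X) {h. src X h = tgt X g} (\<lambda>h. mult X h g)"
proof -
  have "smooth_map_within (arrs X) (arrs X) {h. src X h = tgt X g} (\<lambda>h. case (h, g) of (g, h) \<Rightarrow> mult X g h)"
    by (rule smooth_map_within_compose[OF manifolds(2) smooth_manifold_prod[OF manifolds(2,2)] manifolds(2) _ _ smooth_mult])
      (auto intro: smooth_map_on_Pair[OF manifolds(2,2,2) open_UNIV smooth_map_id smooth_map_const] manifolds)
  then show ?thesis by simp
qed

lemma smooth_left_mult_invs:
  "smooth_map_within (arrs X) (arrs X) {h. src X h = src X g} (\<lambda>h. mult X g (invs X h))"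
proof -
  have "smooth_map_within (arrs X) (arrs X) {h. src X h = src X g} (\<lambda>h. case (g, invs X h) of (g, h) \<Rightarrow> mult X g h)"
    by (rule smooth_map_within_compose[OF manifolds(2) smooth_manifold_prod[OF manifolds(2,2)] manifolds(2) _ _ smooth_mult])
      (auto intro: smooth_map_on_Pair[OF manifolds(2,2,2) open_UNIV smooth_map_const smooth_maps(3)] manifolds)
  then show ?thesis by simp
qed

text \<open>Stated at arbitrary h, because curves are also translated from an arrow back to a
  unit.\<close>

lemma curve_at_right_mult:
  assumes "curve_at (arrs X) \<gamma> h v" "\<And>t. src X (\<gamma> t) = tgt X g"
  shows "curve_at (arrs X) (\<lambda>t. mult X (\<gamma> t) g) (mult X h g)
    (tangent_map_within (arrs X) (arrs X) {h. src X h = tgt X g} (\<lambda>h. mult X h g) h v)"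
  by (rule curve_at_within[OF manifolds(2,2) _ smooth_right_mult assms(1)])
    (use assms(2) assms(2)[of 0] curve_at_0[OF assms(1)] in auto)

lemma curve_at_right_diff:
  assumes "curve_at (arrs X) \<gamma> (ident X (tgt X g)) v" "\<And>t. src X (\<gamma> t) = tgt X g"
  shows "curve_at (arrs X) (\<lambda>t. mult X (\<gamma> t) g) g (right_diff X g v)"
  using curve_at_right_mult[OF assms] by (simp add: right_diff_def)

lemma curve_at_left_diff:
  assumes "curve_at (arrs X) \<gamma> (ident X (src X g)) v" "\<And>t. src X (\<gamma> t) = src X g"
  shows "curve_at (arrs X) (\<lambda>t. mult X g (invs X (\<gamma> t))) g (left_diff X g v)"
  using curve_at_within[OF manifolds(2,2) _ smooth_left_mult_invs assms(1), of g] assms(2)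
  by (simp add: left_diff_def)

lemma obtain_algebroid_curve:
  assumes "\<alpha> \<in> algebroid_fibre X x"
  obtains \<gamma> where "curve_at (arrs X) \<gamma> (ident X x) \<alpha>" "\<And>t. src X (\<gamma> t) = x"
  using assms obtain_src_fibre_curve unfolding algebroid_fibre_def by (metis ident_simps(1))

lemma tangent_to_src_fibre:
  assumes "\<alpha> \<in> algebroid_fibre X x"
  shows "tangent_to (arrs X) {h. src X h = x} (ident X x) \<alpha>"
proof -
  obtain \<gamma> where "curve_at (arrs X) \<gamma> (ident X x) \<alpha>" "\<And>t. src X (\<gamma> t) = x"
    using obtain_algebroid_curve[OF assms] by blast
  then show ?thesis by (auto simp: tangent_to_def)
qed

lemma algebroid_fibreI:
  assumes "curve_at (arrs X) \<gamma> (ident X x) \<alpha>" "\<And>t. src X (\<gamma> t) = x"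
  shows "\<alpha> \<in> algebroid_fibre X x"
  unfolding algebroid_fibre_def by (rule curve_at_ker_ds[OF assms(1)]) (simp add: assms(2))

lemma subspace_algebroid_fibre: "subspace (algebroid_fibre X x)"
  unfolding algebroid_fibre_def by (rule subspace_ker_ds)

text \<open>Right translation by the inverse of g undoes right translation by g; its differential at
  g is a left inverse.\<close>

lemma inj_on_right_diff: "inj_on (right_diff X g) (algebroid_fibre X (tgt X g))"
proof (rule inj_on_inverseI)
  fix \<alpha> assume "\<alpha> \<in> algebroid_fibre X (tgt X g)"
  then obtain \<gamma> where \<gamma>: "curve_at (arrs X) \<gamma> (ident X (tgt X g)) \<alpha>" "\<And>t. src X (\<gamma> t) = tgt X g"
    using obtain_algebroid_curve by blast
  have "curve_at (arrs X) (\<lambda>t. mult X (mult X (\<gamma> t) g) (invs X g)) (mult X g (invs X g))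
      (tangent_map_within (arrs X) (arrs X) {h. src X h = tgt X (invs X g)} (\<lambda>h. mult X h (invs X g)) g (right_diff X g \<alpha>))"
    by (rule curve_at_right_mult[OF curve_at_right_diff[OF \<gamma>]]) (simp add: \<gamma>(2))
  moreover have "mult X (mult X (\<gamma> t) g) (invs X g) = \<gamma> t" for t
    by (simp add: mult_assoc \<gamma>(2))
  ultimately show "tangent_map_within (arrs X) (arrs X) {h. src X h = tgt X (invs X g)} (\<lambda>h. mult X h (invs X g)) g
      (right_diff X g \<alpha>) = \<alpha>"
    using \<gamma>(1) curve_at_unique by simp
qed

lemma right_diff_minus:
  assumes "\<alpha> \<in> algebroid_fibre X (tgt X g)"
  shows "right_diff X g (- \<alpha>) = - right_diff X g \<alpha>"
proof -
  note T = tangent_to_src_fibre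
  have unit: "ident X (tgt X g) \<in> {h. src X h = tgt X g}" by simp
  obtain L where L: "linear L" "\<And>v. tangent_to (arrs X) {h. src X h = tgt X g} (ident X (tgt X g)) v \<Longrightarrow> right_diff X g v = L v"
    unfolding right_diff_def using tangent_map_within_linear[OF manifolds(2,2) unit smooth_right_mult] by blast
  show ?thesis
    using L(2)[OF T[OF assms]] L(2)[OF T[OF subspace_neg[OF subspace_algebroid_fibre assms]]] linear_neg[OF L(1)] by simp
qed

section \<open>Ehresmann connections\<close>

text \<open>Injectivity of \<open>right_diff\<close> gives uniqueness in the definite description; a
  candidate is exhibited where the lemma is applied.\<close>

lemma vert_part_eq:
  assumes "\<alpha> \<in> algebroid_fibre X (tgt X g)" "right_diff X g \<alpha> + hor_lift X H g (ds g v) = v"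
  shows "vert_part X H g v = \<alpha>"
  unfolding vert_part_def
proof (rule the_equality)
  fix \<beta> assume "\<beta> \<in> algebroid_fibre X (tgt X g) \<and> right_diff X g \<beta> + hor_lift X H g (ds g v) = v"
  then show "\<beta> = \<alpha>"
    using assms inj_on_right_diff by (metis add_right_cancel inj_onD)
qed (use assms in simp)

text \<open>A trivial intersection with ker ds gives injectivity. For surjectivity, a preimage under
  the submersion is replaced by its horizontal summand. That H is a subspace comes from its local
  frames.\<close>

lemma bij_betw_ds_horizontal:
  assumes "ehresmann_connection X H"
  shows "bij_betw (ds g) (H g) UNIV" and "subspace (H g)"
proof -
  have H: "H g \<inter> ker_ds X g = {0}" "\<And>v. \<exists>h\<in>H g. \<exists>k\<in>ker_ds X g. v = h + k"
    using assms by (auto simp: ehresmann_connection_def)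
  obtain k :: nat and W Y where "g \<in> W"
      "\<forall>p\<in>W. inj_on (\<lambda>i. Y i p) {..<k} \<and> independent ((\<lambda>i. Y i p) ` {..<k}) \<and> H p = span ((\<lambda>i. Y i p) ` {..<k})"
    using assms unfolding ehresmann_connection_def smooth_subbundle_def by metis
  then show sub: "subspace (H g)"
    using subspace_span by metis
  have "inj_on (ds g) (H g)"
  proof (rule inj_onI)
    fix v w assume vw: "v \<in> H g" "w \<in> H g" "ds g v = ds g w"
    then have "v - w \<in> H g \<inter> ker_ds X g"
      using subspace_diff[OF sub] by (simp add: ker_ds_def linear_diff[OF linear_ds])
    then show "v = w" using H(1) by auto
  qed
  moreover have "y \<in> ds g ` H g" for y
  proof -
    obtain v where "ds g v = y"
      using submersions(1) unfolding submersion_def surj_def by metis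
    moreover obtain h k where "h \<in> H g" "k \<in> ker_ds X g" "v = h + k"
      using H(2) by blast
    ultimately show ?thesis
      by (auto simp: linear_add[OF linear_ds] ker_ds_def)
  qed
  ultimately show "bij_betw (ds g) (H g) UNIV"
    by (auto simp: bij_betw_def)
qed

lemma ds_hor_lift:
  assumes "ehresmann_connection X H"
  shows "ds g (hor_lift X H g w) = w"
  unfolding hor_lift_def
  using bij_betw_ds_horizontal(1)[OF assms] by (intro f_the_inv_into_f) (auto simp: bij_betw_def)

lemma hor_lift_in:
  assumes "ehresmann_connection X H"
  shows "hor_lift X H g w \<in> H g"
  unfolding hor_lift_def
  using bij_betw_ds_horizontal(1)[OF assms, of g] by (intro the_inv_into_into) (auto simp: bij_betw_def)

text \<open>Both sides of each linearity equation are horizontal and have the same image under ds,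
  which is injective there.\<close>

lemma linear_hor_lift:
  assumes "ehresmann_connection X H"
  shows "linear (hor_lift X H g)"
proof -
  note sub = bij_betw_ds_horizontal(2)[OF assms, of g]
  have inj: "inj_on (ds g) (H g)"
    using bij_betw_ds_horizontal(1)[OF assms] by (auto simp: bij_betw_def)
  show ?thesis
    by (intro linearI inj_onD[OF inj])
      (simp_all add: linear_add[OF linear_ds] linear_scale[OF linear_ds] ds_hor_lift[OF assms]
        hor_lift_in[OF assms] subspace_add[OF sub] subspace_scale[OF sub])
qed

end

section \<open>Principal bundles\<close>

locale principal_gpd_bundle = lie_gpd X
  for X :: "('o::{t2_space, second_countable_topology}, 'eo::model_space,
             'g::{t2_space, second_countable_topology}, 'eg::model_space) groupoid" +
  fixes B :: "('p::{t2_space, second_countable_topology}, 'ep::model_space,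
               'm::{t2_space, second_countable_topology}, 'em::model_space, 'o, 'g) gpd_bundle"
  assumes principal: "principal_bundle X B"
begin

abbreviation "dpi \<equiv> tangent_map (total B) (base B) (proj B)"
abbreviation "da \<equiv> tangent_map (total B) (objs X) (anchor B)"

lemma bundle_manifolds: "smooth_manifold (total B)" "smooth_manifold (base B)"
  using principal by (simp_all add: principal_bundle_def)

lemma submersion_proj: "submersion (total B) (base B) (proj B)"
  using principal by (simp add: principal_bundle_def)

lemma bundle_smooth_maps:
  "smooth_map (total B) (base B) (proj B)" "smooth_map (total B) (objs X) (anchor B)"
  using principal by (simp_all add: principal_bundle_def right_action_def submersion_def)

lemma smooth_act:
  "smooth_map_within (prod_manifold (total B) (arrs X)) (total B) (action_domain X B) (\<lambda>(p, g). act B p g)"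
  using principal by (simp add: principal_bundle_def right_action_def)

lemma act_simps [simp]:
  "anchor B p = tgt X g \<Longrightarrow> anchor B (act B p g) = src X g"
  "x = anchor B p \<Longrightarrow> act B p (ident X x) = p"
  "anchor B p = tgt X g \<Longrightarrow> proj B (act B p g) = proj B p"
  using principal by (auto simp add: principal_bundle_def right_action_def)

lemma act_act: "anchor B p = tgt X g \<Longrightarrow> src X g = tgt X h \<Longrightarrow> act B (act B p g) h = act B p (mult X g h)"
  using principal by (auto simp add: principal_bundle_def right_action_def)

lemma linear_dpi: "linear (dpi p)" and linear_da: "linear (da p)"
  using linear_smooth_map bundle_manifolds manifolds bundle_smooth_maps by blast+

lemma curve_at_act:
  assumes "curve_at (total B) \<gamma> p u" "curve_at (arrs X) \<eta> g \<beta>" "\<And>t. anchor B (\<gamma> t) = tgt X (\<eta> t)"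
  shows "curve_at (total B) (\<lambda>t. act B (\<gamma> t) (\<eta> t)) (act B p g) (act_diff X B p g u \<beta>)"
proof -
  have "(p, g) \<in> action_domain X B"
    using assms(3)[of 0] curve_at_0[OF assms(1)] curve_at_0[OF assms(2)] by (simp add: action_domain_def)
  from curve_at_within[OF smooth_manifold_prod[OF bundle_manifolds(1) manifolds(2)] bundle_manifolds(1) this smooth_act
      curve_at_Pair[OF assms(1,2)]]
  show ?thesis by (simp add: act_diff_def action_domain_def assms(3))
qed

lemma tangent_to_action_domain:
  assumes "anchor B p = tgt X g" "da p u = dt g \<beta>"
  shows "tangent_to (prod_manifold (total B) (arrs X)) (action_domain X B) (p, g) (u, \<beta>)"
  unfolding action_domain_def
  by (rule tangent_to_fibre_product[OF bundle_manifolds(1) manifolds(2,1) bundle_smooth_maps(2) submersions(2) assms])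

lemma smooth_delta: "smooth_map_within (arrs X) (total B) {h. src X h = anchor B p} (\<lambda>h. act B p (invs X h))"
proof -
  have "smooth_map_within (arrs X) (total B) {h. src X h = anchor B p}
      (\<lambda>h. case (p, invs X h) of (p, g) \<Rightarrow> act B p g)"
    by (rule smooth_map_within_compose[OF manifolds(2) smooth_manifold_prod[OF bundle_manifolds(1) manifolds(2)]
          bundle_manifolds(1) _ _ smooth_act])
      (auto simp: action_domain_def manifolds
        intro: smooth_map_on_Pair[OF manifolds(2) bundle_manifolds(1) manifolds(2) open_UNIV smooth_map_const smooth_maps(3)])
  then show ?thesis by simp
qed

section \<open>The vertical bundle of P\<close>

lemma curve_at_delta_diff:
  assumes "curve_at (arrs X) \<gamma> (ident X (anchor B p)) \<alpha>" "\<And>t. src X (\<gamma> t) = anchor B p"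
  shows "curve_at (total B) (\<lambda>t. act B p (invs X (\<gamma> t))) p (delta_diff X B p \<alpha>)"
  using curve_at_within[OF manifolds(2) bundle_manifolds(1) _ smooth_delta assms(1)] assms(2)
  by (simp add: delta_diff_def)

lemma delta_diff_linear:
  obtains L where "linear L" "\<And>\<alpha>. \<alpha> \<in> algebroid_fibre X (anchor B p) \<Longrightarrow> delta_diff X B p \<alpha> = L \<alpha>"
proof -
  have unit: "ident X (anchor B p) \<in> {h. src X h = anchor B p}" by simp
  obtain L where L: "linear L" "\<And>v. tangent_to (arrs X) {h. src X h = anchor B p} (ident X (anchor B p)) v \<Longrightarrow>
      delta_diff X B p v = L v"
    unfolding delta_diff_def
    using tangent_map_within_linear[OF manifolds(2) bundle_manifolds(1) unit smooth_delta] by blast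
  show thesis
    by (rule that[OF L(1)]) (rule L(2)[OF tangent_to_src_fibre])
qed

lemma delta_diff_in_ker_dpi:
  assumes "\<alpha> \<in> algebroid_fibre X (anchor B p)"
  shows "delta_diff X B p \<alpha> \<in> ker_dpi B p"
proof -
  obtain \<gamma> where \<gamma>: "curve_at (arrs X) \<gamma> (ident X (anchor B p)) \<alpha>" "\<And>t. src X (\<gamma> t) = anchor B p"
    using obtain_algebroid_curve[OF assms] by blast
  have "dpi p (delta_diff X B p \<alpha>) = 0"
    by (rule tangent_map_curve[OF bundle_manifolds bundle_smooth_maps(1) curve_at_delta_diff[OF \<gamma>], where q = "proj B p"])
      (simp_all add: \<gamma>(2) curve_at_const)
  then show ?thesis by (simp add: ker_dpi_def)
qed

text \<open>A curve \<open>\<eta>\<close> in the fibre of \<open>\<pi>\<close> through \<open>q\<close> is \<open>t \<mapsto> q g\<^sub>t\<close>, where the smoothness of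
  \<open>g\<^sub>t\<close> comes from the inverse of \<open>(p, g) \<mapsto> (p, pg)\<close>.\<close>

lemma ker_dpi_delta_diff:
  assumes "v \<in> ker_dpi B q"
  obtains \<alpha> where "\<alpha> \<in> algebroid_fibre X (anchor B q)" "delta_diff X B q \<alpha> = v"
proof -
  let ?S = "action_domain X B" and ?T = "{(p, q). proj B p = proj B q}" and ?f = "\<lambda>(p, g). (p, act B p g)"
  have bij: "bij_betw ?f ?S ?T"
    and inv: "smooth_map_within (prod_manifold (total B) (total B)) (prod_manifold (total B) (arrs X)) ?T (inv_into ?S ?f)"
    using principal by (simp_all add: principal_bundle_def diffeomorphism_within_def)
  have "tangent_to (total B) {p. proj B p = proj B q} q v"
    by (rule tangent_to_fibre[OF bundle_manifolds submersion_proj]) (use assms in \<open>simp add: ker_dpi_def\<close>)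
  then obtain \<eta> where \<eta>: "curve_at (total B) \<eta> q v" "\<And>t. proj B (\<eta> t) = proj B q"
    by (auto simp: tangent_to_def)
  define \<gamma> where "\<gamma> t = snd (inv_into ?S ?f (q, \<eta> t))" for t
  have \<gamma>: "anchor B q = tgt X (\<gamma> t)" "act B q (\<gamma> t) = \<eta> t" for t
  proof -
    have "(q, \<eta> t) \<in> ?f ` ?S"
      using bij \<eta>(2)[of t] by (simp add: bij_betw_def)
    then have "inv_into ?S ?f (q, \<eta> t) \<in> ?S" "?f (inv_into ?S ?f (q, \<eta> t)) = (q, \<eta> t)"
      using inv_into_into[of "(q, \<eta> t)" ?f ?S] f_inv_into_f[of "(q, \<eta> t)" ?f ?S] by blast+
    then show "anchor B q = tgt X (\<gamma> t)" "act B q (\<gamma> t) = \<eta> t"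
      by (auto simp: \<gamma>_def action_domain_def split: prod.splits)
  qed
  \<comment> \<open>At time 0 the curve is at q, so the inverse returns the unit, and the velocity
    found below lives over the unit as \<open>delta_diff\<close> requires.\<close>
  have inv0: "inv_into ?S ?f (q, q) = (q, ident X (anchor B q))"
    using inv_into_f_f[of ?f ?S "(q, ident X (anchor B q))"] bij
    by (simp add: bij_betw_def action_domain_def)
  define z where "z = tangent_map_within (prod_manifold (total B) (total B)) (prod_manifold (total B) (arrs X)) ?T
    (inv_into ?S ?f) (q, q) (0, v)"
  have z: "curve_at (prod_manifold (total B) (arrs X)) (\<lambda>t. inv_into ?S ?f (q, \<eta> t)) (q, ident X (anchor B q)) (fst z, snd z)"
    using curve_at_within[OF smooth_manifold_prod[OF bundle_manifolds(1,1)] smooth_manifold_prod[OF bundle_manifolds(1) manifolds(2)]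
        _ inv curve_at_Pair[OF curve_at_const[of _ q] \<eta>(1)]] \<eta>(2) by (simp add: inv0 z_def)
  have w: "curve_at (arrs X) \<gamma> (ident X (anchor B q)) (snd z)"
    using curve_at_snd[OF z] by (simp add: \<gamma>_def[abs_def])
  \<comment> \<open>The map \<delta> is h \<mapsto> q \<open>invs X h\<close>, so the arrows found
    above have to be inverted; this also moves them into the source fibre.\<close>
  let ?\<alpha> = "di (ident X (anchor B q)) (snd z)"
  have h: "curve_at (arrs X) (\<lambda>t. invs X (\<gamma> t)) (ident X (anchor B q)) ?\<alpha>"
    using curve_at_smooth_map[OF manifolds(2,2) smooth_maps(3) w] by simp
  have "delta_diff X B q ?\<alpha> = v"
    using curve_at_unique[OF curve_at_delta_diff[OF h]] \<eta>(1) \<gamma> by simp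
  moreover have "?\<alpha> \<in> algebroid_fibre X (anchor B q)"
    by (rule algebroid_fibreI[OF h]) (simp add: \<gamma>(1)[symmetric])
  ultimately show thesis using that by blast
qed

section \<open>The quasi actions induced by a connection\<close>

context
  fixes H assumes H: "ehresmann_connection X H"
begin

text \<open>Since t i = s, this reduces to ds after \<sigma>. It makes the pair acted on in the
  definition of \<tau> tangent to the action domain.\<close>

lemma dt_di_hor_lift: "dt g (di (invs X g) (hor_lift X H (invs X g) w)) = w"
proof -
  obtain \<gamma> where \<gamma>: "curve_at (arrs X) \<gamma> (invs X g) (hor_lift X H (invs X g) w)"
    using obtain_curve[OF manifolds(2)] .
  have "curve_at (objs X) (\<lambda>t. tgt X (invs X (\<gamma> t))) (tgt X g) (dt g (di (invs X g) (hor_lift X H (invs X g) w)))"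
    using curve_at_smooth_map[OF manifolds(2,1) smooth_maps(2) curve_at_smooth_map[OF manifolds(2,2) smooth_maps(3) \<gamma>]]
    by simp
  moreover have "curve_at (objs X) (\<lambda>t. src X (\<gamma> t)) (tgt X g) w"
    using curve_at_smooth_map[OF manifolds(2,1) smooth_maps(1) \<gamma>] by (simp add: ds_hor_lift[OF H])
  ultimately show ?thesis
    using curve_at_unique by simp
qed

lemma tangent_to_quasi_action:
  assumes "anchor B p = tgt X g"
  shows "tangent_to (prod_manifold (total B) (arrs X)) (action_domain X B) (p, g)
    (u, di (invs X g) (hor_lift X H (invs X g) (da p u)))"
  by (rule tangent_to_action_domain[OF assms]) (simp add: dt_di_hor_lift)

text \<open>The inner map u \<mapsto> (u, di \<sigma> da u) is linear and takes values in vectors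
  tangent to the action domain, where the differential of the action agrees with a linear L.\<close>

lemma linear_quasi_action_tangent:
  assumes "anchor B p = tgt X g"
  shows "linear (quasi_action_tangent X B H p g)"
proof -
  have pg: "(p, g) \<in> action_domain X B" using assms by (simp add: action_domain_def)
  obtain L where L: "linear L"
    "\<And>v. tangent_to (prod_manifold (total B) (arrs X)) (action_domain X B) (p, g) v \<Longrightarrow>
      tangent_map_within (prod_manifold (total B) (arrs X)) (total B) (action_domain X B) (\<lambda>(p, g). act B p g) (p, g) v = L v"
    using tangent_map_within_linear[OF smooth_manifold_prod[OF bundle_manifolds(1) manifolds(2)] bundle_manifolds(1) pg smooth_act]
    by blast
  have "quasi_action_tangent X B H p g = (\<lambda>u. L (u, di (invs X g) (hor_lift X H (invs X g) (da p u))))"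
    unfolding quasi_action_tangent_def act_diff_def
    using L(2) tangent_to_quasi_action[OF assms] by blast
  moreover have "linear (\<lambda>u. (u, di (invs X g) (hor_lift X H (invs X g) (da p u))))"
    by (rule linearI) (simp_all add: linear_add[OF linear_da] linear_add[OF linear_di] linear_add[OF linear_hor_lift[OF H]]
        linear_scale[OF linear_da] linear_scale[OF linear_di] linear_scale[OF linear_hor_lift[OF H]])
  ultimately show ?thesis
    using linear_compose[OF _ L(1)] by (simp add: o_def)
qed

text \<open>Projecting a curve \<gamma> g of acted-on points gives the projection of \<gamma>. Since
  the result does not involve H, the quasi actions of two connections differ by a vertical
  vector.\<close>

lemma dpi_quasi_action_tangent:
  assumes "anchor B p = tgt X g"
  shows "dpi (act B p g) (quasi_action_tangent X B H p g u) = dpi p u"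
proof -
  obtain \<gamma> where \<gamma>: "curve_at (prod_manifold (total B) (arrs X)) \<gamma> (p, g)
      (u, di (invs X g) (hor_lift X H (invs X g) (da p u)))" "\<And>t. \<gamma> t \<in> action_domain X B"
    using tangent_to_quasi_action[OF assms] by (auto simp: tangent_to_def)
  have anch: "anchor B (fst (\<gamma> t)) = tgt X (snd (\<gamma> t))" for t
    using \<gamma>(2)[of t] by (auto simp: action_domain_def)
  have "curve_at (total B) (\<lambda>t. act B (fst (\<gamma> t)) (snd (\<gamma> t))) (act B p g) (quasi_action_tangent X B H p g u)"
    unfolding quasi_action_tangent_def by (rule curve_at_act[OF curve_at_fst[OF \<gamma>(1)] curve_at_snd[OF \<gamma>(1)] anch])
  moreover have "curve_at (base B) (\<lambda>t. proj B (act B (fst (\<gamma> t)) (snd (\<gamma> t)))) (proj B p) (dpi p u)"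
    using curve_at_smooth_map[OF bundle_manifolds bundle_smooth_maps(1) curve_at_fst[OF \<gamma>(1)]] by (simp add: anch)
  ultimately show ?thesis
    using tangent_map_curve[OF bundle_manifolds bundle_smooth_maps(1)] assms by simp
qed

text \<open>With \<open>\<kappa> = \<sigma>\<^bsub>g\<inverse>\<^esub>(dt \<alpha>)\<close>, the vector \<open>\<kappa> - l \<alpha>\<close> is tangent to the source fibre. So there are
  curves \<open>\<eta>\<close> and \<open>j\<close> in that fibre with velocities \<open>\<alpha>\<close> and \<open>\<kappa> - l \<alpha>\<close>, and \<open>k = j \<eta>\<inverse>\<close> has velocity
  \<open>\<kappa>\<close>. Both sides are then velocities of \<open>(p \<eta>\<inverse>) k\<inverse> = (p g) (j g)\<inverse>\<close>.\<close>

lemma quasi_action_delta_diff: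
  assumes pg: "anchor B p = tgt X g" and \<alpha>: "\<alpha> \<in> algebroid_fibre X (anchor B p)"
  shows "quasi_action_alg X H (invs X g) \<alpha> \<in> algebroid_fibre X (src X g)"
    and "quasi_action_tangent X B H p g (delta_diff X B p \<alpha>) =
      delta_diff X B (act B p g) (quasi_action_alg X H (invs X g) \<alpha>)"
proof -
  let ?x = "anchor B p" and ?g' = "invs X g"
  let ?l = "left_diff X ?g' \<alpha>" and ?\<kappa> = "hor_lift X H ?g' (dt (ident X ?x) \<alpha>)"
  obtain \<eta> where \<eta>: "curve_at (arrs X) \<eta> (ident X ?x) \<alpha>" "\<And>t. src X (\<eta> t) = ?x"
    using obtain_algebroid_curve[OF \<alpha>] by blast
  note tgt_\<eta> = curve_at_smooth_map[OF manifolds(2,1) smooth_maps(2) \<eta>(1)]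
  have l: "curve_at (arrs X) (\<lambda>t. mult X ?g' (invs X (\<eta> t))) ?g' ?l"
    by (rule curve_at_left_diff) (use \<eta> pg in auto)
  \<comment> \<open>The source of \<open>mult X g' (invs X (\<eta> t))\<close> is the target of
    \<eta> t.\<close>
  have ds_l: "ds ?g' ?l = dt (ident X ?x) \<alpha>"
    by (rule tangent_map_curve[OF manifolds(2,1) smooth_maps(1) l, where q = ?x]) (use tgt_\<eta> \<eta>(2) pg in auto)
  have "?\<kappa> - ?l \<in> ker_ds X ?g'"
    using pg by (simp add: ker_ds_def linear_diff[OF linear_ds] ds_hor_lift[OF H] ds_l)
  then obtain j where j: "curve_at (arrs X) j ?g' (?\<kappa> - ?l)" "\<And>t. src X (j t) = ?x"
    using obtain_src_fibre_curve pg by (metis invs_simps(1))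
  have inv_\<eta>: "curve_at (arrs X) (\<lambda>t. invs X (\<eta> t)) (ident X ?x) (di (ident X ?x) \<alpha>)"
    using curve_at_smooth_map[OF manifolds(2,2) smooth_maps(3) \<eta>(1)] by simp
  have k: "curve_at (arrs X) (\<lambda>t. mult X (j t) (invs X (\<eta> t))) ?g' ?\<kappa>"
  proof -
    \<comment> \<open>Freeze one factor at a time: with the second at the unit the product is j,
      with the first at \<open>invs X g\<close> it is the curve that defines l. The velocities add
      up to (\<kappa> - l) + l.\<close>
    have "dmult ?g' (ident X ?x) (?\<kappa> - ?l) (di (ident X ?x) \<alpha>) =
        dmult ?g' (ident X ?x) (?\<kappa> - ?l) 0 + dmult ?g' (ident X ?x) 0 (di (ident X ?x) \<alpha>)"
    proof (rule dmult_split)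
      show "?\<kappa> - ?l \<in> ker_ds X ?g'" by fact
      show "dt (ident X ?x) (di (ident X ?x) \<alpha>) = 0"
        by (rule tangent_map_curve[OF manifolds(2,1) smooth_maps(2) inv_\<eta>, where q = ?x]) (simp_all add: \<eta>(2) curve_at_const)
    qed (simp add: pg)
    also have "dmult ?g' (ident X ?x) (?\<kappa> - ?l) 0 = ?\<kappa> - ?l"
      using curve_at_unique[OF curve_at_mult[OF j(1) curve_at_const[of "arrs X" "ident X ?x"]]] j pg by simp
    also have "dmult ?g' (ident X ?x) 0 (di (ident X ?x) \<alpha>) = ?l"
      using curve_at_unique[OF curve_at_mult[OF curve_at_const[of "arrs X" ?g'] inv_\<eta>]] l \<eta>(2) pg by simp
    finally show ?thesis
      using curve_at_mult[OF j(1) inv_\<eta>] j(2) \<eta>(2) pg by simp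
  qed
  have \<delta>: "curve_at (total B) (\<lambda>t. act B p (invs X (\<eta> t))) p (delta_diff X B p \<alpha>)"
    by (rule curve_at_delta_diff[OF \<eta>])
  \<comment> \<open>This identifies the horizontal lift in the definition of \<tau> with
    \<kappa>.\<close>
  have "da p (delta_diff X B p \<alpha>) = dt (ident X ?x) \<alpha>"
    by (rule tangent_map_curve[OF bundle_manifolds(1) manifolds(1) bundle_smooth_maps(2) \<delta>, where q = ?x])
      (use tgt_\<eta> \<eta>(2) in auto)
  then have \<tau>: "curve_at (total B) (\<lambda>t. act B (act B p (invs X (\<eta> t))) (invs X (mult X (j t) (invs X (\<eta> t)))))
      (act B p g) (quasi_action_tangent X B H p g (delta_diff X B p \<alpha>))"
    using curve_at_act[OF \<delta> curve_at_smooth_map[OF manifolds(2,2) smooth_maps(3) k]] j(2) \<eta>(2)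
    by (simp add: quasi_action_tangent_def)
  \<comment> \<open>The velocity of j g, which starts at a unit; it turns out to be the value of
    \<lambda>.\<close>
  define \<beta> where "\<beta> = tangent_map_within (arrs X) (arrs X) {h. src X h = tgt X g} (\<lambda>h. mult X h g) ?g' (?\<kappa> - ?l)"
  have b: "curve_at (arrs X) (\<lambda>t. mult X (j t) g) (ident X (src X g)) \<beta>" "\<And>t. src X (mult X (j t) g) = src X g"
    using curve_at_right_mult[OF j(1), of g] j(2) pg by (simp_all add: \<beta>_def)
  have \<beta>: "\<beta> \<in> algebroid_fibre X (src X g)"
    by (rule algebroid_fibreI[OF b])
  have "curve_at (total B) (\<lambda>t. act B (act B p g) (invs X (mult X (j t) g))) (act B p g) (delta_diff X B (act B p g) \<beta>)"
    by (rule curve_at_delta_diff) (use b pg in auto)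
  \<comment> \<open>In both products everything cancels except the inverse of j t.\<close>
  moreover have "act B (act B p (invs X (\<eta> t))) (invs X (mult X (j t) (invs X (\<eta> t)))) = act B p (invs X (j t))"
    "act B (act B p g) (invs X (mult X (j t) g)) = act B p (invs X (j t))" for t
    using pg j(2) \<eta>(2) by (simp_all add: invs_mult act_act)
  ultimately have 1: "quasi_action_tangent X B H p g (delta_diff X B p \<alpha>) = delta_diff X B (act B p g) \<beta>"
    using \<tau> curve_at_unique by simp
  have "curve_at (arrs X) (\<lambda>t. mult X (mult X (j t) g) ?g') ?g' (right_diff X ?g' \<beta>)"
    by (rule curve_at_right_diff) (use b in auto)
  then have r: "right_diff X ?g' \<beta> = ?\<kappa> - ?l"
    using curve_at_unique[OF j(1)] j(2) pg by (simp add: mult_assoc)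
  \<comment> \<open>Indeed -(\<kappa> - l) + \<kappa> = l. The sign in the definition of \<lambda>
    then turns -\<beta> into \<beta>.\<close>
  have "vert_part X H ?g' ?l = - \<beta>"
    by (rule vert_part_eq) (use \<beta> subspace_neg[OF subspace_algebroid_fibre] in \<open>auto simp: right_diff_minus r ds_l\<close>)
  then have "quasi_action_alg X H ?g' \<alpha> = \<beta>"
    by (simp add: quasi_action_alg_def)
  then show "quasi_action_alg X H ?g' \<alpha> \<in> algebroid_fibre X (src X g)"
    "quasi_action_tangent X B H p g (delta_diff X B p \<alpha>) = delta_diff X B (act B p g) (quasi_action_alg X H ?g' \<alpha>)"
    using \<beta> 1 by simp_all
qed

end

end

section \<open>Change of connection pairs\<close>

lemma linear_coord_change:
  assumes N: "smooth_manifold N" and c: "c \<in> charts N" "d \<in> charts N" and p: "p \<in> fst c" "p \<in> fst d"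
  shows "linear (coord_change c d p)"
proof -
  have "smooth_on (snd c ` (fst c \<inter> fst d)) (snd d \<circ> chart_inv c)"
    using N c by (simp add: smooth_manifold_def)
  from has_derivative_linear[OF smooth_on_derivative[OF this, of "snd c p"]] show ?thesis
    using p by (simp add: coord_change_def)
qed

text \<open>Both maps lie over the same f, and the coordinate change in the target is linear, so the
  local expression of the difference is the difference of the local expressions.\<close>

lemma smooth_bundle_map_diff:
  fixes N :: "('a::{t2_space, second_countable_topology}, 'e::model_space) manifold"
    and Q :: "('b::{t2_space, second_countable_topology}, 'f::model_space) manifold"
  assumes M: "smooth_manifold N" "smooth_manifold Q"
    and F: "smooth_bundle_map N Q f F" and G: "smooth_bundle_map N Q f G"
  shows "smooth_bundle_map N Q f (\<lambda>p v. F p v - G p v)"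
  unfolding smooth_bundle_map_def
proof (intro conjI allI ballI)
  show f: "smooth_map N Q f" using F by (simp add: smooth_bundle_map_def)
  show "linear (\<lambda>v. F p v - G p v)" for p
    using F G by (auto simp: smooth_bundle_map_def intro: linear_compose_sub)
  fix c d assume c: "c \<in> charts N" and d: "d \<in> charts Q"
  let ?U = "(snd c ` (fst c \<inter> f -` fst d)) \<times> (UNIV :: 'e set)"
  let ?rep = "\<lambda>F (x, v). let p = chart_inv c x in
      coord_change (chart_at Q (f p)) d (f p) (F p (coord_change c (chart_at N p) p v))"
  have U: "open ?U"
    using smooth_map_on_chart(1)[OF M open_UNIV f c d] by (simp add: open_Times)
  have "smooth_on ?U (\<lambda>z. ?rep F z - ?rep G z)"
    using F G c d by (intro smooth_on_diff[OF U]) (auto simp: smooth_bundle_map_def)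
  then show "smooth_on ?U (?rep (\<lambda>p v. F p v - G p v))"
  proof (rule iffD1[OF smooth_on_cong[OF U], rotated])
    fix z assume "z \<in> ?U"
    then obtain p v where z: "z = (snd c p, v)" "p \<in> fst c" "f p \<in> fst d" by auto
    have "linear (coord_change (chart_at Q (f p)) d (f p))"
      using smooth_manifold_chart_at[OF M(2)] z(3) by (intro linear_coord_change[OF M(2) _ d])
    then show "?rep F z - ?rep G z = ?rep (\<lambda>p v. F p v - G p v) z"
      by (simp add: z chart_inv_chart[OF M(1) c] linear_diff)
  qed
qed

context principal_gpd_bundle
begin

lemma algebroid_form_diff:
  assumes "algebroid_form X B \<omega>" "algebroid_form X B \<theta>"
  shows "algebroid_form X B (\<lambda>p u. \<omega> p u - \<theta> p u)"
  using assms smooth_bundle_map_diff[OF bundle_manifolds(1) manifolds(2)] subspace_diff[OF subspace_algebroid_fibre]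
  by (simp add: algebroid_form_def)

lemma linear_algebroid_form: "algebroid_form X B \<omega> \<Longrightarrow> linear (\<omega> p)"
  by (simp add: algebroid_form_def smooth_bundle_map_def)

context
  fixes \<omega> :: "'p \<Rightarrow> 'ep \<Rightarrow> 'eg"
  assumes form: "algebroid_form X B \<omega>"
    and normalized: "\<And>p \<alpha>. \<alpha> \<in> algebroid_fibre X (anchor B p) \<Longrightarrow> \<omega> p (delta_diff X B p \<alpha>) = \<alpha>"
begin

lemma form_in_fibre: "\<omega> p u \<in> algebroid_fibre X (anchor B p)"
  using form by (simp add: algebroid_form_def)

text \<open>The normalization makes \<omega> a left inverse of \<open>delta_diff\<close>, which
  gives injectivity; vertical vectors are exactly its values.\<close>

lemma the_inv_into_delta_diff:
  assumes "v \<in> ker_dpi B p"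
  shows "the_inv_into (algebroid_fibre X (anchor B p)) (delta_diff X B p) v = \<omega> p v"
proof -
  obtain \<alpha> where "\<alpha> \<in> algebroid_fibre X (anchor B p)" "delta_diff X B p \<alpha> = v"
    using ker_dpi_delta_diff[OF assms] .
  moreover have "inj_on (delta_diff X B p) (algebroid_fibre X (anchor B p))"
    using normalized by (rule inj_on_inverseI)
  ultimately show ?thesis
    using normalized by (auto simp: the_inv_into_f_f)
qed

lemma delta_diff_form:
  assumes "v \<in> ker_dpi B p"
  shows "delta_diff X B p (\<omega> p v) = v"
  using ker_dpi_delta_diff[OF assms] normalized by metis

text \<open>Apply \<omega> to the intertwining relation of \<open>quasi_action_delta_diff\<close>.
  Here H may be any connection, whether or not \<omega> is equivariant for it.\<close>

lemma quasi_action_alg_eq: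
  assumes "ehresmann_connection X H" "anchor B p = tgt X g" "\<alpha> \<in> algebroid_fibre X (anchor B p)"
  shows "quasi_action_alg X H (invs X g) \<alpha> = \<omega> (act B p g) (quasi_action_tangent X B H p g (delta_diff X B p \<alpha>))"
  using quasi_action_delta_diff[OF assms] normalized assms(2) by simp

text \<open>By \<open>quasi_action_alg_eq\<close>, \<lambda> is a composite of
  \<open>delta_diff\<close>, \<tau> and \<omega>, each of which respects differences.\<close>

lemma quasi_action_alg_diff:
  assumes H: "ehresmann_connection X H" and pg: "anchor B p = tgt X g"
    and \<alpha>: "\<alpha> \<in> algebroid_fibre X (anchor B p)" and \<beta>: "\<beta> \<in> algebroid_fibre X (anchor B p)"
  shows "quasi_action_alg X H (invs X g) (\<alpha> - \<beta>) =
    quasi_action_alg X H (invs X g) \<alpha> - quasi_action_alg X H (invs X g) \<beta>"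
proof -
  obtain L where L: "linear L" "\<And>\<alpha>. \<alpha> \<in> algebroid_fibre X (anchor B p) \<Longrightarrow> delta_diff X B p \<alpha> = L \<alpha>"
    using delta_diff_linear by blast
  have d: "\<alpha> - \<beta> \<in> algebroid_fibre X (anchor B p)"
    using subspace_diff[OF subspace_algebroid_fibre \<alpha> \<beta>] .
  show ?thesis
    unfolding quasi_action_alg_eq[OF H pg \<alpha>] quasi_action_alg_eq[OF H pg \<beta>] quasi_action_alg_eq[OF H pg d]
    by (simp add: L(2)[OF \<alpha>] L(2)[OF \<beta>] L(2)[OF d] linear_diff[OF L(1)]
        linear_diff[OF linear_quasi_action_tangent[OF H pg]] linear_diff[OF linear_algebroid_form[OF form]])
qed

end

lemma connection_form_quasi_action:
  assumes \<omega>: "connection_pair X B \<omega> H" and H': "ehresmann_connection X H'"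
    and pg: "anchor B p = tgt X g" and u\<^sub>1: "\<omega> p u\<^sub>1 = 0" and u\<^sub>2: "u\<^sub>2 \<in> ker_dpi B p"
  shows "\<omega> (act B p g) (quasi_action_tangent X B H' p g (u\<^sub>1 + u\<^sub>2)) =
    the_inv_into (algebroid_fibre X (anchor B (act B p g))) (delta_diff X B (act B p g))
      (quasi_action_tangent X B H' p g u\<^sub>1 - quasi_action_tangent X B H p g u\<^sub>1)
    + quasi_action_alg X H' (invs X g) (\<omega> p (u\<^sub>1 + u\<^sub>2))"
proof -
  let ?q = "act B p g" and ?\<tau> = "quasi_action_tangent X B H p g" and ?\<tau>' = "quasi_action_tangent X B H' p g"
  have H: "ehresmann_connection X H" and form: "algebroid_form X B \<omega>"
    and equiv: "\<omega> ?q (?\<tau> u) = quasi_action_alg X H (invs X g) (\<omega> p u)"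
    and normalized: "\<And>p \<alpha>. \<alpha> \<in> algebroid_fibre X (anchor B p) \<Longrightarrow> \<omega> p (delta_diff X B p \<alpha>) = \<alpha>" for u
    using \<omega> pg by (auto simp: connection_pair_def)
  note lin = linear_algebroid_form[OF form]
  \<comment> \<open>Together with equivariance this shows that \<tau> preserves the kernel of
    \<omega>, so the term \<omega> (\<tau> \<open>u\<^sub>1\<close>) vanishes.\<close>
  have alg0: "quasi_action_alg X H (invs X g) 0 = 0"
    using quasi_action_alg_diff[OF form normalized H pg, of 0 0] subspace_0[OF subspace_algebroid_fibre] by simp
  have "?\<tau>' u\<^sub>1 - ?\<tau> u\<^sub>1 \<in> ker_dpi B ?q"
    by (simp add: ker_dpi_def linear_diff[OF linear_dpi] dpi_quasi_action_tangent[OF H pg] dpi_quasi_action_tangent[OF H' pg])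
  from the_inv_into_delta_diff[OF form normalized this]
  have 1: "the_inv_into (algebroid_fibre X (anchor B ?q)) (delta_diff X B ?q) (?\<tau>' u\<^sub>1 - ?\<tau> u\<^sub>1) = \<omega> ?q (?\<tau>' u\<^sub>1)"
    by (simp add: linear_diff[OF lin] equiv u\<^sub>1 alg0)
  \<comment> \<open>A vertical vector is \<open>delta_diff\<close> of its own
    \<omega>-value.\<close>
  have 2: "quasi_action_alg X H' (invs X g) (\<omega> p u\<^sub>2) = \<omega> ?q (?\<tau>' u\<^sub>2)"
    using quasi_action_alg_eq[OF form normalized H' pg form_in_fibre[OF form normalized]]
    by (simp add: delta_diff_form[OF form normalized u\<^sub>2])
  show ?thesis
    unfolding 1 by (simp add: linear_add[OF lin] linear_add[OF linear_quasi_action_tangent[OF H' pg]] u\<^sub>1 2)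
qed

end

theorem proposition20:
  fixes X :: "('o::{t2_space, second_countable_topology}, 'eo::model_space,
               'g::{t2_space, second_countable_topology}, 'eg::model_space) groupoid"
    and B :: "('p::{t2_space, second_countable_topology}, 'ep::model_space,
               'm::{t2_space, second_countable_topology}, 'em::model_space, 'o, 'g) gpd_bundle"
    and \<omega> :: "'p \<Rightarrow> 'ep \<Rightarrow> 'eg"
    and \<sigma> \<sigma>' :: "'g \<Rightarrow> 'eg set"
  assumes "lie_groupoid X"
    and "principal_bundle X B"
    and "connection_pair X B \<omega> \<sigma>"
    and "ehresmann_connection X \<sigma>'"
  shows "(\<forall>\<theta>. algebroid_form X B \<theta> \<and> change_condition X B \<omega> \<sigma> \<sigma>' \<theta> \<longrightarrow>
            connection_pair X B (\<lambda>p u. \<omega> p u - \<theta> p u) \<sigma>') \<and>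
         (\<forall>\<omega>'. connection_pair X B \<omega>' \<sigma>' \<longrightarrow>
            change_condition X B \<omega> \<sigma> \<sigma>' (\<lambda>p u. \<omega> p u - \<omega>' p u))"
proof -
  interpret principal_gpd_bundle X B
    using assms(1,2) by unfold_locales
  note \<omega> = assms(3) and \<sigma>' = assms(4)
  have form: "algebroid_form X B \<omega>"
    and normalized: "\<And>p \<alpha>. \<alpha> \<in> algebroid_fibre X (anchor B p) \<Longrightarrow> \<omega> p (delta_diff X B p \<alpha>) = \<alpha>"
    using \<omega> by (auto simp: connection_pair_def)
  note fibre = form_in_fibre[OF form normalized]
  show ?thesis
  proof (intro conjI allI impI)
    fix \<theta> assume "algebroid_form X B \<theta> \<and> change_condition X B \<omega> \<sigma> \<sigma>' \<theta>"
    then have \<theta>: "algebroid_form X B \<theta>" and change: "change_condition X B \<omega> \<sigma> \<sigma>' \<theta>" by auto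
    have \<theta>_fibre: "\<theta> p u \<in> algebroid_fibre X (anchor B p)" for p u
      using \<theta> by (simp add: algebroid_form_def)
    show "connection_pair X B (\<lambda>p u. \<omega> p u - \<theta> p u) \<sigma>'"
      unfolding connection_pair_def
    proof (intro conjI allI impI ballI)
      show "algebroid_form X B (\<lambda>p u. \<omega> p u - \<theta> p u)"
        by (rule algebroid_form_diff[OF form \<theta>])
      show "\<omega> p (delta_diff X B p \<alpha>) - \<theta> p (delta_diff X B p \<alpha>) = \<alpha>"
        if "\<alpha> \<in> algebroid_fibre X (anchor B p)" for p \<alpha>
        using that change normalized by (simp add: change_condition_def)
      fix p g u assume pg: "anchor B p = tgt X g"
      \<comment> \<open>The vertical component of u in the splitting of TP: subtracting it leaves a
        vector in the kernel of \<omega>, to which the change condition applies.\<close>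
      define u\<^sub>2 where "u\<^sub>2 = delta_diff X B p (\<omega> p u)"
      have u\<^sub>2: "u\<^sub>2 \<in> ker_dpi B p"
        unfolding u\<^sub>2_def by (rule delta_diff_in_ker_dpi[OF fibre])
      have u\<^sub>1: "\<omega> p (u - u\<^sub>2) = 0"
        by (simp add: linear_diff[OF linear_algebroid_form[OF form]] u\<^sub>2_def normalized[OF fibre])
      have "\<theta> (act B p g) (quasi_action_tangent X B \<sigma>' p g u) =
          quasi_action_alg X \<sigma>' (invs X g) (\<theta> p u) +
          the_inv_into (algebroid_fibre X (anchor B (act B p g))) (delta_diff X B (act B p g))
            (quasi_action_tangent X B \<sigma>' p g (u - u\<^sub>2) - quasi_action_tangent X B \<sigma> p g (u - u\<^sub>2))"
        using change pg u\<^sub>1 u\<^sub>2 unfolding change_condition_def by (metis diff_add_cancel)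
      \<comment> \<open>The term with the inverse of \<open>delta_diff\<close> occurs in both
        formulas and cancels. As \<omega> and \<theta> take values in the algebroid fibre, the
        remaining two terms combine.\<close>
      then show "\<omega> (act B p g) (quasi_action_tangent X B \<sigma>' p g u) - \<theta> (act B p g) (quasi_action_tangent X B \<sigma>' p g u) =
          quasi_action_alg X \<sigma>' (invs X g) (\<omega> p u - \<theta> p u)"
        using connection_form_quasi_action[OF \<omega> \<sigma>' pg u\<^sub>1 u\<^sub>2]
        by (simp add: quasi_action_alg_diff[OF form normalized \<sigma>' pg fibre \<theta>_fibre])
    qed (rule \<sigma>')
  next
    fix \<omega>' assume \<omega>': "connection_pair X B \<omega>' \<sigma>'"
    have \<omega>'_fibre: "\<omega>' p u \<in> algebroid_fibre X (anchor B p)" for p u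
      using \<omega>' by (simp add: connection_pair_def algebroid_form_def)
    show "change_condition X B \<omega> \<sigma> \<sigma>' (\<lambda>p u. \<omega> p u - \<omega>' p u)"
      unfolding change_condition_def
    proof (intro conjI allI impI ballI)
      show "\<omega> p (delta_diff X B p \<alpha>) - \<omega>' p (delta_diff X B p \<alpha>) = 0"
        if "\<alpha> \<in> algebroid_fibre X (anchor B p)" for p \<alpha>
        using that \<omega>' normalized by (simp add: connection_pair_def)
      fix p g u u\<^sub>1 u\<^sub>2
      assume "anchor B p = tgt X g \<and> \<omega> p u\<^sub>1 = 0 \<and> u\<^sub>2 \<in> ker_dpi B p \<and> u = u\<^sub>1 + u\<^sub>2"
      then have pg: "anchor B p = tgt X g" and u: "\<omega> p u\<^sub>1 = 0" "u\<^sub>2 \<in> ker_dpi B p" "u = u\<^sub>1 + u\<^sub>2" by auto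
      have "\<omega>' (act B p g) (quasi_action_tangent X B \<sigma>' p g u) = quasi_action_alg X \<sigma>' (invs X g) (\<omega>' p u)"
        using \<omega>' pg by (simp add: connection_pair_def)
      then show "\<omega> (act B p g) (quasi_action_tangent X B \<sigma>' p g u) - \<omega>' (act B p g) (quasi_action_tangent X B \<sigma>' p g u) =
          quasi_action_alg X \<sigma>' (invs X g) (\<omega> p u - \<omega>' p u) +
          the_inv_into (algebroid_fibre X (anchor B (act B p g))) (delta_diff X B (act B p g))
            (quasi_action_tangent X B \<sigma>' p g u\<^sub>1 - quasi_action_tangent X B \<sigma> p g u\<^sub>1)"
        using connection_form_quasi_action[OF \<omega> \<sigma>' pg u(1,2)]
        by (simp add: u(3) quasi_action_alg_diff[OF form normalized \<sigma>' pg fibre \<omega>'_fibre])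
    qed
  qed
qed

end
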